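(* Let $c\ge 1$ be a constant. If there exists a polynomial time grammar-based compressor $\mathcal{C}$ with $\alpha_{\mathcal{C}}(2,n)\le c$ for all $n$, then there exists a polynomial time grammar-based compressor $\mathcal{D}$ with $\alpha_{\mathcal{D}}(n)\le 6c$ for all $n$.
   Context: A straight-line program (SLP) over a finite alphabet $\Sigma$ is a context-free grammar $\mathbb{A}=(N,\Sigma,P,S)$ with a finite set $N$ of nonterminals ($N\cap\Sigma=\emptyset$), start nonterminal $S\in N$, and a finite set $P$ of productions $A\to w$ with $A\in N$, $w\in(N\cup\Sigma)^+$, such that (i) for every $A\in N$ there is exactly one production with left-hand side $A$, and (ii) the relation $\{(A,B)\in N\times N \mid (A\to w)\in P,\ B \text{ occurs in } w\}$ is acyclic. Every nonterminal $A$ produces a unique word $\mathrm{val}(A)\in\Sigma^+$, and $\mathrm{val}(\mathbb{A})=\mathrm{val}(S)$. The size of $\mathbb{A}$ is $|\mathbb{A}|=\sum_{(A\to w)\in P}|w|$. For a nonempty word $w$, $g(w)$ denotes the size of a smallest SLP producing $w$. A grammar-based compressor $\mathcal{C}$ is an algorithm that computes for each nonempty word $w$ an SLP $\mathcal{C}(w)$ with $\mathrm{val}(\mathcal{C}(w))=w$. With $[1,k]=\{1,\dots,k\}$, its worst-case approximation ratio over words of length $n$ over an alphabet of size $k$ is $$\alpha_{\mathcal{C}}(k,n)=\max\{|\mathcal{C}(w)|/g(w) \mid w\in[1,k]^n\},$$ and $\alpha_{\mathcal{C}}(n)=\alpha_{\mathcal{C}}(n,n)$ (the case of no restriction on the alphabet).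 *)

theory Defs
  imports Complex_Main "HOL-Computational_Algebra.Polynomial"
begin

section \<open>Straight-line programs\<close>

text \<open>
  The disjointness of nonterminals and terminals is built into the two constructors. Nonterminals
  are named by natural numbers; a straight-line program has finitely many nonterminals, and neither
  its size nor its value depends on their names. Letters are natural numbers as well; the alphabets
  of interest are the sets \<open>{1..k}\<close>.
\<close>

datatype sym = NT nat | Tm nat

record grammar =
  nonterminals :: "nat set"
  productions :: "(nat \<times> sym list) set"
  start :: nat

definition slp_over :: "nat set \<Rightarrow> grammar \<Rightarrow> bool" where
  "slp_over \<Sigma> G \<longleftrightarrow>
     finite \<Sigma> \<and> finite (nonterminals G) \<and> finite (productions G) \<and>
     start G \<in> nonterminals G \<and>
     (\<forall>(A, \<alpha>) \<in> productions G.
        A \<in> nonterminals G \<and> \<alpha> \<noteq> [] \<and> set \<alpha> \<subseteq> NT ` nonterminals G \<union> Tm ` \<Sigma>) \<and>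
     (\<forall>A \<in> nonterminals G. \<exists>!\<alpha>. (A, \<alpha>) \<in> productions G) \<and>
     acyclic {(A, B). A \<in> nonterminals G \<and> B \<in> nonterminals G \<and>
                      (\<exists>\<alpha>. (A, \<alpha>) \<in> productions G \<and> NT B \<in> set \<alpha>)}"

definition slp :: "grammar \<Rightarrow> bool" where
  "slp G \<longleftrightarrow> (\<exists>\<Sigma>. slp_over \<Sigma> G)"

inductive derives1 :: "grammar \<Rightarrow> sym list \<Rightarrow> sym list \<Rightarrow> bool" for G where
  "(A, \<alpha>) \<in> productions G \<Longrightarrow> derives1 G (u @ [NT A] @ v) (u @ \<alpha> @ v)"

definition nt_val :: "grammar \<Rightarrow> nat \<Rightarrow> nat list" where
  "nt_val G A = (THE w. (derives1 G)\<^sup>*\<^sup>* [NT A] (map Tm w))"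

definition slp_val :: "grammar \<Rightarrow> nat list" where
  "slp_val G = nt_val G (start G)"

definition slp_size :: "grammar \<Rightarrow> nat" where
  "slp_size G = (\<Sum>(A, \<alpha>) \<in> productions G. length \<alpha>)"

definition smallest_slp_size :: "nat list \<Rightarrow> nat" where
  "smallest_slp_size w = (LEAST m. \<exists>G. slp G \<and> slp_val G = w \<and> slp_size G = m)"


section \<open>Compressors and their approximation ratio\<close>

definition input_words :: "nat list set" where
  "input_words = {w. w \<noteq> [] \<and> (\<forall>a \<in> set w. 1 \<le> a)}"

definition compressor :: "(nat list \<Rightarrow> grammar) \<Rightarrow> bool" where
  "compressor C \<longleftrightarrow> (\<forall>w \<in> input_words. slp (C w) \<and> slp_val (C w) = w)"

text \<open>Only meaningful for \<open>k \<ge> 1\<close> and \<open>n \<ge> 1\<close>, since compressors act on nonempty words.\<close>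

definition approx_ratio :: "(nat list \<Rightarrow> grammar) \<Rightarrow> nat \<Rightarrow> nat \<Rightarrow> real" where
  "approx_ratio C k n =
     Max {real (slp_size (C w)) / real (smallest_slp_size w) | w. length w = n \<and> set w \<subseteq> {1..k}}"


section \<open>Polynomial time\<close>

text \<open>
  The machine model is the language of while programs on binary trees (S-expressions without
  atoms; cf. Jones, Computability and Complexity from a Programming Perspective). Building a tree
  is charged by the size of the result (logarithmic cost), so that a run of cost \<open>t\<close> can neither
  create nor output data of size more than \<open>t\<close>. Hence such programs and Turing machines simulate
  each other with polynomial overhead.
\<close>

datatype tree = Leaf | Node tree tree

fun left :: "tree \<Rightarrow> tree" where
  "left Leaf = Leaf"
| "left (Node l r) = l"

fun right :: "tree \<Rightarrow> tree" where
  "right Leaf = Leaf"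
| "right (Node l r) = r"

type_synonym state = "nat \<Rightarrow> tree"

datatype expr = LeafE | VarE nat | NodeE nat nat | LeftE nat | RightE nat

fun expr_val :: "expr \<Rightarrow> state \<Rightarrow> tree" where
  "expr_val LeafE s = Leaf"
| "expr_val (VarE x) s = s x"
| "expr_val (NodeE x y) s = Node (s x) (s y)"
| "expr_val (LeftE x) s = left (s x)"
| "expr_val (RightE x) s = right (s x)"

datatype com =
    Skip
  | Assign nat expr
  | Seq com com
  | IfNode nat com com
  | WhileNode nat com

text \<open>\<open>exec p s t s'\<close>: program \<open>p\<close>, started in state \<open>s\<close>, halts in state \<open>s'\<close> at cost \<open>t\<close>. The
  conditions of \<open>IfNode x\<close> and \<open>WhileNode x\<close> hold iff variable \<open>x\<close> is not \<open>Leaf\<close>.\<close>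

inductive exec :: "com \<Rightarrow> state \<Rightarrow> nat \<Rightarrow> state \<Rightarrow> bool" where
  Skip: "exec Skip s 1 s"
| Assign: "exec (Assign x e) s (1 + size (expr_val e s)) (s(x := expr_val e s))"
| Seq: "exec p s t s' \<Longrightarrow> exec q s' t' s'' \<Longrightarrow> exec (Seq p q) s (t + t') s''"
| IfTrue: "s x \<noteq> Leaf \<Longrightarrow> exec p s t s' \<Longrightarrow> exec (IfNode x p q) s (1 + t) s'"
| IfFalse: "s x = Leaf \<Longrightarrow> exec q s t s' \<Longrightarrow> exec (IfNode x p q) s (1 + t) s'"
| WhileFalse: "s x = Leaf \<Longrightarrow> exec (WhileNode x p) s 1 s"
| WhileTrue: "s x \<noteq> Leaf \<Longrightarrow> exec p s t s' \<Longrightarrow> exec (WhileNode x p) s' t' s'' \<Longrightarrow>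
    exec (WhileNode x p) s (1 + t + t') s''"

text \<open>Input and output are passed in variable \<open>0\<close>; all other variables are initially \<open>Leaf\<close>.\<close>

definition outputs_within :: "com \<Rightarrow> tree \<Rightarrow> nat \<Rightarrow> tree \<Rightarrow> bool" where
  "outputs_within p x t y \<longleftrightarrow> (\<exists>t' s. exec p ((\<lambda>_. Leaf)(0 := x)) t' s \<and> t' \<le> t \<and> s 0 = y)"

text \<open>Numbers are encoded in binary, least significant bit first.\<close>

fun enc_nat :: "nat \<Rightarrow> tree" where
  "enc_nat n = (if n = 0 then Leaf
     else Node (if odd n then Node Leaf Leaf else Leaf) (enc_nat (n div 2)))"

declare enc_nat.simps [simp del]

definition enc_list :: "('a \<Rightarrow> tree) \<Rightarrow> 'a list \<Rightarrow> tree" where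
  "enc_list f xs = foldr (\<lambda>x t. Node (f x) t) xs Leaf"

definition enc_word :: "nat list \<Rightarrow> tree" where
  "enc_word = enc_list enc_nat"

fun enc_sym :: "sym \<Rightarrow> tree" where
  "enc_sym (NT A) = Node Leaf (enc_nat A)"
| "enc_sym (Tm a) = Node (Node Leaf Leaf) (enc_nat a)"

fun enc_production :: "nat \<times> sym list \<Rightarrow> tree" where
  "enc_production (A, \<alpha>) = Node (enc_nat A) (enc_list enc_sym \<alpha>)"

text \<open>
  A tree describes a grammar by its start nonterminal and a list of its productions in any order.
  The nonterminals of a straight-line program are the left-hand sides of its productions.
\<close>

definition encodes_slp :: "tree \<Rightarrow> grammar \<Rightarrow> bool" where
  "encodes_slp y G \<longleftrightarrow>
     (\<exists>ps. distinct ps \<and> set ps = productions G \<and>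
           y = Node (enc_nat (start G)) (enc_list enc_production ps))"

definition polytime_compressor :: "(nat list \<Rightarrow> grammar) \<Rightarrow> bool" where
  "polytime_compressor C \<longleftrightarrow> compressor C \<and>
     (\<exists>(p :: com) (b :: nat poly). \<forall>w \<in> input_words. \<exists>y.
        outputs_within p (enc_word w) (poly b (size (enc_word w))) y \<and> encodes_slp y (C w))"

end

theory Submission
  imports Defs
begin

text \<open>
  Let \<open>a\<^sub>0, \<dots>, a\<^sub>k\<^sub>-\<^sub>1\<close> be the distinct letters of \<open>w\<close>, and let \<open>\<phi>\<close> map \<open>a\<^sub>i\<close> to \<open>1\<^sup>i 2\<close>. Since \<open>2k\<close>
  symbols suffice to produce all code words and every program for \<open>w\<close> has size at least \<open>k\<close>, we have
  \<open>g(\<phi>(w)) \<le> g(w) + 2k \<le> 3 g(w)\<close>. Conversely, let \<open>A \<rightarrow> X\<^sub>1 \<dots> X\<^sub>m\<close> be a production of a program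
  for \<open>\<phi>(w)\<close>. If \<open>val(A)\<close> contains a \<open>2\<close>, it is of the form \<open>1\<^sup>i 2 \<phi>(u) 1\<^sup>j\<close>, and the new
  nonterminal \<open>A\<close> is to produce \<open>u\<close>: it suffices to keep the \<open>X\<^sub>l\<close> with nonempty inner word, and to insert
  one letter where the \<open>1\<close>s pending after one \<open>X\<^sub>l\<close> meet the next \<open>2\<close>. So the right-hand sides at most
  double, and compressing \<open>\<phi>(w)\<close> by \<open>\<C>\<close> and decoding the result loses the factor \<open>2 \<cdot> 3\<close>.

  For the running time, the functions on encoded data that while programs compute in polynomial
  time are closed under composition, case distinction and folding over lists with polynomially
  bounded intermediate results. As the productions come in no particular order,
  the data \<open>i\<close>, \<open>j\<close> and the new right-hand sides are computed by iterating over all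
  productions as often as there are productions.
\<close>

section \<open>Polynomial bounds\<close>

text \<open>Unary codes are used because each is the previous one with a 1 in front: a chain of
  short productions yields all of them at a cost linear in k, comparable with g(w), while \<phi>(w)
  has length at most k|w| and so stays polynomial. The obstacle in decoding is that a code may
  straddle two symbols. An offset of 1s before a text changes only the first number decoded from it,
  so just that one letter is left to the context, and the rest can be fixed for a nonterminal once
  and for all. The second obstacle is that \<C> may return useless nonterminals with exponentially
  long values, so counts of 1s cannot be kept exactly. They are represented by suffixes of the list
  of letters: dropping adds counts and saturates at the end of the list, and the head of what
  remains is the decoded letter. This also spares the programs any arithmetic. For the time bound,
  iterating a polynomial-time step may square the data in each round. Hence every loop comes with
  its own size estimate.\<close>

definition poly_bounded :: "(nat \<Rightarrow> nat) \<Rightarrow> bool" where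
  "poly_bounded h \<longleftrightarrow> (\<exists>b :: nat poly. \<forall>n. h n \<le> poly b n)"

named_theorems pb_intros
named_theorems pt_intros

text \<open>Natural coefficients make polynomials monotone, so a time bound survives when an input
  size is replaced by an upper bound for it.\<close>

lemma poly_nat_mono: "m \<le> n \<Longrightarrow> poly (b :: nat poly) m \<le> poly b n"
  by (induction b) (auto intro: add_mono mult_mono)

lemma poly_bounded_poly [pb_intros]: "poly_bounded (poly b)"
  unfolding poly_bounded_def by blast

lemma poly_bounded_const [pb_intros]: "poly_bounded (\<lambda>_. c)"
  unfolding poly_bounded_def by (rule exI[of _ "[:c:]"]) simp

lemma poly_bounded_id [pb_intros]: "poly_bounded (\<lambda>n. n)"
  unfolding poly_bounded_def by (rule exI[of _ "[:0, 1:]"]) simp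

lemma poly_bounded_add [pb_intros]:
  assumes "poly_bounded f" "poly_bounded g"
  shows "poly_bounded (\<lambda>n. f n + g n)"
proof -
  obtain a b where "\<And>n. f n \<le> poly a n" "\<And>n. g n \<le> poly b n"
    using assms unfolding poly_bounded_def by blast
  then have "\<forall>n. f n + g n \<le> poly (a + b) n" by (auto intro: add_mono)
  then show ?thesis unfolding poly_bounded_def by blast
qed

lemma poly_bounded_mult [pb_intros]:
  assumes "poly_bounded f" "poly_bounded g"
  shows "poly_bounded (\<lambda>n. f n * g n)"
proof -
  obtain a b where "\<And>n. f n \<le> poly a n" "\<And>n. g n \<le> poly b n"
    using assms unfolding poly_bounded_def by blast
  then have "\<forall>n. f n * g n \<le> poly (a * b) n" by (auto intro: mult_mono)
  then show ?thesis unfolding poly_bounded_def by blast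
qed

lemma poly_bounded_poly_comp [pb_intros]:
  assumes "poly_bounded f"
  shows "poly_bounded (\<lambda>n. poly b (f n))"
proof -
  obtain a where "\<And>n. f n \<le> poly a n"
    using assms unfolding poly_bounded_def by blast
  then have "\<forall>n. poly b (f n) \<le> poly (pcompose b a) n"
    by (auto simp: poly_pcompose intro: poly_nat_mono)
  then show ?thesis unfolding poly_bounded_def by blast
qed


section \<open>Running programs\<close>

text \<open>A total-correctness triple with a cost budget for one initial state; budgets of composed
  programs add up by rules like \<open>runs_Seq\<close>.\<close>

definition runs :: "com \<Rightarrow> state \<Rightarrow> nat \<Rightarrow> (state \<Rightarrow> bool) \<Rightarrow> bool" where
  "runs p s T Q \<longleftrightarrow> (\<exists>t s'. exec p s t s' \<and> t \<le> T \<and> Q s')"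

lemma runs_mono: "runs p s T Q \<Longrightarrow> T \<le> T' \<Longrightarrow> (\<And>s'. Q s' \<Longrightarrow> Q' s') \<Longrightarrow> runs p s T' Q'"
  unfolding runs_def by (meson le_trans)

lemma runs_Skip: "Q s \<Longrightarrow> runs Skip s 1 Q"
  unfolding runs_def by (blast intro: exec.Skip)

lemma runs_Assign:
  "Q (s(x := expr_val e s)) \<Longrightarrow> runs (Assign x e) s (1 + size (expr_val e s)) Q"
  unfolding runs_def by (blast intro: exec.Assign)

lemma runs_Seq:
  "runs p s T R \<Longrightarrow> (\<And>s'. R s' \<Longrightarrow> runs q s' T' Q) \<Longrightarrow> runs (Seq p q) s (T + T') Q"
  unfolding runs_def by (meson exec.Seq add_mono)

lemma runs_If:
  "(s x \<noteq> Leaf \<Longrightarrow> runs p s T Q) \<Longrightarrow> (s x = Leaf \<Longrightarrow> runs q s T Q) \<Longrightarrow>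
   runs (IfNode x p q) s (1 + T) Q"
  unfolding runs_def by (metis exec.IfFalse exec.IfTrue add_le_mono order_refl)

lemma runs_While_False: "s x = Leaf \<Longrightarrow> Q s \<Longrightarrow> runs (WhileNode x p) s 1 Q"
  unfolding runs_def by (blast intro: exec.WhileFalse)

lemma runs_While_True:
  assumes "s x \<noteq> Leaf" "runs p s T R" "\<And>s'. R s' \<Longrightarrow> runs (WhileNode x p) s' T' Q"
  shows "runs (WhileNode x p) s (1 + T + T') Q"
proof -
  obtain t s' where 1: "exec p s t s'" "t \<le> T" "R s'"
    using assms(2) unfolding runs_def by blast
  obtain t' s'' where 2: "exec (WhileNode x p) s' t' s''" "t' \<le> T'" "Q s''"
    using assms(3)[OF 1(3)] unfolding runs_def by blast
  have "exec (WhileNode x p) s (1 + t + t') s''"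
    using assms(1) 1(1) 2(1) by (rule exec.WhileTrue)
  then show ?thesis unfolding runs_def using 1 2 by (meson add_mono order_refl)
qed

lemma outputs_within_runs:
  "outputs_within p x T y \<longleftrightarrow> runs p ((\<lambda>_. Leaf)(0 := x)) T (\<lambda>s. s 0 = y)"
  unfolding outputs_within_def runs_def by blast

lemma outputs_within_mono: "outputs_within p x T y \<Longrightarrow> T \<le> T' \<Longrightarrow> outputs_within p x T' y"
  unfolding outputs_within_def using le_trans by blast

text \<open>An assignment pays for the whole tree it writes. So time bounds are also size bounds,
  which keeps the input of a subsequent program polynomial.\<close>

lemma exec_size: "exec p s t s' \<Longrightarrow> size (s' v) \<le> size (s v) + t"
  by (induction rule: exec.induct) auto

lemma outputs_within_size:
  assumes "outputs_within p x T y"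
  shows "size y \<le> size x + T"
proof -
  obtain t s where "exec p ((\<lambda>_. Leaf)(0 := x)) t s" "t \<le> T" "s 0 = y"
    using assms unfolding outputs_within_def by blast
  then show ?thesis using exec_size[of p "(\<lambda>_. Leaf)(0 := x)" t s 0] by simp
qed


section \<open>Subroutines\<close>

text \<open>Relocation of a subroutine: with all its registers moved to \<open>N\<close> and above,
  the caller's data below \<open>N\<close> survive.\<close>

fun shift_expr :: "nat \<Rightarrow> expr \<Rightarrow> expr" where
  "shift_expr N LeafE = LeafE"
| "shift_expr N (VarE x) = VarE (x + N)"
| "shift_expr N (NodeE x y) = NodeE (x + N) (y + N)"
| "shift_expr N (LeftE x) = LeftE (x + N)"
| "shift_expr N (RightE x) = RightE (x + N)"

fun shift :: "nat \<Rightarrow> com \<Rightarrow> com" where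
  "shift N Skip = Skip"
| "shift N (Assign x e) = Assign (x + N) (shift_expr N e)"
| "shift N (Seq p q) = Seq (shift N p) (shift N q)"
| "shift N (IfNode x p q) = IfNode (x + N) (shift N p) (shift N q)"
| "shift N (WhileNode x p) = WhileNode (x + N) (shift N p)"

fun expr_bound :: "expr \<Rightarrow> nat" where
  "expr_bound LeafE = 0"
| "expr_bound (VarE x) = Suc x"
| "expr_bound (NodeE x y) = max (Suc x) (Suc y)"
| "expr_bound (LeftE x) = Suc x"
| "expr_bound (RightE x) = Suc x"

fun com_bound :: "com \<Rightarrow> nat" where
  "com_bound Skip = 0"
| "com_bound (Assign x e) = max (Suc x) (expr_bound e)"
| "com_bound (Seq p q) = max (com_bound p) (com_bound q)"
| "com_bound (IfNode x p q) = max (Suc x) (max (com_bound p) (com_bound q))"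
| "com_bound (WhileNode x p) = max (Suc x) (com_bound p)"

lemma expr_val_shift:
  "expr_bound e \<le> M \<Longrightarrow> \<forall>v<M. S (v + N) = s v \<Longrightarrow> expr_val (shift_expr N e) S = expr_val e s"
  by (cases e) auto

lemma exec_shift:
  assumes "exec p s t s'" "com_bound p \<le> M" "\<forall>v<M. S (v + N) = s v"
  shows "\<exists>S'. exec (shift N p) S t S' \<and> (\<forall>v<M. S' (v + N) = s' v) \<and> (\<forall>v<N. S' v = S v)"
  using assms
proof (induction arbitrary: S rule: exec.induct)
  case (Skip s)
  then show ?case by (auto intro!: exI[of _ S] exec.Skip[unfolded One_nat_def])
next
  case (Assign x e s)
  have e: "expr_val (shift_expr N e) S = expr_val e s"
    using Assign by (intro expr_val_shift[of _ M]) auto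
  have "exec (shift N (Assign x e)) S (1 + size (expr_val e s)) (S(x + N := expr_val e s))"
    using exec.Assign[of "x + N" "shift_expr N e" S] unfolding e by simp
  moreover have "\<forall>v<M. (S(x + N := expr_val e s)) (v + N) = (s(x := expr_val e s)) v"
    "\<forall>v<N. (S(x + N := expr_val e s)) v = S v"
    using Assign(2) by auto
  ultimately show ?case by blast
next
  case (Seq p s t s' q t' s'')
  have "com_bound p \<le> M" "com_bound q \<le> M" using Seq.prems by auto
  then obtain S' where S': "exec (shift N p) S t S'" "\<forall>v<M. S' (v + N) = s' v" "\<forall>v<N. S' v = S v"
    using Seq.IH(1) Seq.prems by blast
  obtain S'' where "exec (shift N q) S' t' S''" "\<forall>v<M. S'' (v + N) = s'' v" "\<forall>v<N. S'' v = S' v"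
    using Seq.IH(2) S' \<open>com_bound q \<le> M\<close> by blast
  then show ?case using S' by (auto intro: exec.Seq)
next
  case (IfTrue s x p t s' q)
  have "com_bound p \<le> M" "x < M" using IfTrue.prems by auto
  then obtain S' where S': "exec (shift N p) S t S'" "\<forall>v<M. S' (v + N) = s' v" "\<forall>v<N. S' v = S v"
    using IfTrue.IH IfTrue.prems by blast
  have "S (x + N) \<noteq> Leaf" using IfTrue \<open>x < M\<close> by auto
  then have "exec (shift N (IfNode x p q)) S (1 + t) S'"
    using S'(1) exec.IfTrue[of S "x + N"] by simp
  then show ?case using S' by blast
next
  case (IfFalse s x q t s' p)
  have "com_bound q \<le> M" "x < M" using IfFalse.prems by auto
  then obtain S' where S': "exec (shift N q) S t S'" "\<forall>v<M. S' (v + N) = s' v" "\<forall>v<N. S' v = S v"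
    using IfFalse.IH IfFalse.prems by blast
  have "S (x + N) = Leaf" using IfFalse \<open>x < M\<close> by auto
  then have "exec (shift N (IfNode x p q)) S (1 + t) S'"
    using S'(1) exec.IfFalse[of S "x + N"] by simp
  then show ?case using S' by blast
next
  case (WhileFalse s x p)
  then have "S (x + N) = Leaf" by auto
  then have "exec (shift N (WhileNode x p)) S 1 S"
    using exec.WhileFalse[of S "x + N"] by simp
  then show ?case using WhileFalse by blast
next
  case (WhileTrue s x p t s' t' s'')
  have b: "com_bound p \<le> M" "x < M" using WhileTrue.prems by auto
  then obtain S' where S': "exec (shift N p) S t S'" "\<forall>v<M. S' (v + N) = s' v" "\<forall>v<N. S' v = S v"
    using WhileTrue.IH(1) WhileTrue.prems by blast
  obtain S'' where S'': "exec (shift N (WhileNode x p)) S' t' S''"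
      "\<forall>v<M. S'' (v + N) = s'' v" "\<forall>v<N. S'' v = S' v"
    using WhileTrue.IH(2) S' WhileTrue.prems by blast
  have "S (x + N) \<noteq> Leaf" using WhileTrue b by auto
  then have "exec (shift N (WhileNode x p)) S (1 + t + t') S''"
    using S'(1) S''(1) exec.WhileTrue[of S "x + N" "shift N p" t S' t' S''] by simp
  then show ?case using S' S'' by auto
qed

text \<open>Programs rely on \<open>Leaf\<close> in all registers but 0. A call inside a loop would
  otherwise find the leftovers of the previous call.\<close>

fun clear :: "nat \<Rightarrow> nat \<Rightarrow> com" where
  "clear N 0 = Skip"
| "clear N (Suc M) = Seq (clear N M) (Assign (M + N) LeafE)"

lemma runs_clear:
  "runs (clear N M) s (1 + M) (\<lambda>s'. (\<forall>v<M. s' (v + N) = Leaf) \<and> (\<forall>v<N. s' v = s v))"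
proof (induction M)
  case 0
  then show ?case using runs_Skip[of "\<lambda>s'. \<forall>v<N. s' v = s v" s] by simp
next
  case (Suc M)
  have "runs (clear N (Suc M)) s ((1 + M) + 1)
    (\<lambda>s'. (\<forall>v<Suc M. s' (v + N) = Leaf) \<and> (\<forall>v<N. s' v = s v))"
    unfolding clear.simps
    by (rule runs_Seq[OF Suc], rule runs_mono[OF runs_Assign[where Q = "\<lambda>s'. (\<forall>v<Suc M. s' (v + N) = Leaf) \<and> (\<forall>v<N. s' v = s v)"]])
      (auto simp: less_Suc_eq)
  then show ?case by simp
qed

definition call :: "nat \<Rightarrow> com \<Rightarrow> nat \<Rightarrow> nat \<Rightarrow> com" where
  "call N p x y =
     Seq (clear N (com_bound p)) (Seq (Assign N (VarE x)) (Seq (shift N p) (Assign y (VarE N))))"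

lemma runs_call:
  assumes "outputs_within p (s x) T r" "x < N" "y < N"
  shows "runs (call N p x y) s (com_bound p + 2 * (size (s x) + T) + 3)
           (\<lambda>s'. s' y = r \<and> (\<forall>v<N. v \<noteq> y \<longrightarrow> s' v = s v))"
proof -
  let ?M = "com_bound p"
  \<comment> \<open>Register 0 carries input and output even if \<open>p\<close> mentions no
    register at all.\<close>
  let ?M' = "max 1 ?M"
  let ?s0 = "(\<lambda>_. Leaf)(0 := s x)"
  let ?Q = "\<lambda>s'. s' y = r \<and> (\<forall>v<N. v \<noteq> y \<longrightarrow> s' v = s v)"
  obtain t s' where r: "exec p ?s0 t s'" "t \<le> T" "s' 0 = r"
    using assms(1) unfolding outputs_within_def by blast
  have sz: "size r \<le> size (s x) + T" using outputs_within_size[OF assms(1)] .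
  have shift: "runs (shift N p) S T (\<lambda>S'. S' N = r \<and> (\<forall>v<N. S' v = s v))"
    if S: "\<forall>v<?M'. S (v + N) = ?s0 v" "\<forall>v<N. S v = s v" for S
  proof -
    obtain S' where "exec (shift N p) S t S'" "\<forall>v<?M'. S' (v + N) = s' v" "\<forall>v<N. S' v = S v"
      using exec_shift[OF r(1) _ S(1)] by auto
    then show ?thesis using r S(2) unfolding runs_def
      by (intro exI[of _ t] exI[of _ S']) (auto dest!: spec[of _ 0])
  qed
  have "runs (call N p x y) s ((1 + ?M) + ((1 + size (s x)) + (T + (1 + size r)))) ?Q"
    unfolding call_def
  proof (rule runs_Seq[OF runs_clear])
    fix s1 assume s1: "(\<forall>v<?M. s1 (v + N) = Leaf) \<and> (\<forall>v<N. s1 v = s v)"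
    have x: "s1 x = s x" using s1 assms(2) by simp
    have a: "runs (Assign N (VarE x)) s1 (1 + size (s x)) (\<lambda>s2. s2 = s1(N := s x))"
      using runs_Assign[of "\<lambda>s2. s2 = s1(N := s x)" s1 N "VarE x"] x by simp
    show "runs (Seq (Assign N (VarE x)) (Seq (shift N p) (Assign y (VarE N)))) s1
       ((1 + size (s x)) + (T + (1 + size r))) ?Q"
    proof (rule runs_Seq[OF a], rule runs_Seq)
      fix s2 assume s2: "s2 = s1(N := s x)"
      show "runs (shift N p) s2 T (\<lambda>S'. S' N = r \<and> (\<forall>v<N. S' v = s v))"
        by (rule shift) (use s1 s2 in auto)
    next
      fix s3 assume s3: "s3 N = r \<and> (\<forall>v<N. s3 v = s v)"
      show "runs (Assign y (VarE N)) s3 (1 + size r) ?Q"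
        using runs_Assign[of ?Q s3 y "VarE N"] s3 assms(3) by simp
    qed
  qed
  then show ?thesis by (rule runs_mono) (use sz in auto)
qed


section \<open>Polynomial-time functions on encoded data\<close>

class enc =
  fixes enc :: "'a \<Rightarrow> tree"

instantiation nat :: enc
begin
definition enc_nat_def: "enc = enc_nat"
instance ..
end

text \<open>The same trees as the bits in \<open>enc_nat\<close> and the tags in
  \<open>enc_sym\<close>, so bits and tags can be read off as booleans.\<close>

instantiation bool :: enc
begin
definition enc_bool_def: "enc b = (if b then Node Leaf Leaf else Leaf)"
instance ..
end

instantiation sym :: enc
begin
definition enc_sym_def: "enc = enc_sym"
instance ..
end

instantiation list :: (enc) enc
begin
definition enc_list_def': "enc = enc_list enc"
instance ..
end

instantiation prod :: (enc, enc) enc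
begin
definition enc_prod_def: "enc p = Node (enc (fst p)) (enc (snd p))"
instance ..
end

lemma enc_simps [simp]:
  "enc ([] :: 'a :: enc list) = Leaf"
  "enc ((x :: 'a :: enc) # xs) = Node (enc x) (enc xs)"
  "enc ((a :: 'b :: enc), (b :: 'c :: enc)) = Node (enc a) (enc b)"
  "enc True = Node Leaf Leaf" "enc False = Leaf"
  "enc (NT A) = Node Leaf (enc A)"
  "enc (Tm A) = Node (Node Leaf Leaf) (enc A)"
  by (simp_all add: enc_list_def' enc_list_def enc_prod_def enc_bool_def enc_sym_def enc_nat_def)

text \<open>Relative to a set of inputs because the given compressor promises its time bound only on
  \<open>input_words\<close>.\<close>

definition pt_on :: "'a :: enc set \<Rightarrow> ('a \<Rightarrow> 'b :: enc) \<Rightarrow> bool" where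
  "pt_on A f \<longleftrightarrow>
     (\<exists>p (b :: nat poly). \<forall>x\<in>A. outputs_within p (enc x) (poly b (size (enc x))) (enc (f x)))"

abbreviation pt :: "('a :: enc \<Rightarrow> 'b :: enc) \<Rightarrow> bool" where
  "pt \<equiv> pt_on UNIV"

lemma pt_onI:
  assumes "poly_bounded h" "\<And>x. x \<in> A \<Longrightarrow> outputs_within p (enc x) (h (size (enc x))) (enc (f x))"
  shows "pt_on A f"
proof -
  obtain b where "\<And>n. h n \<le> poly b n" using assms(1) unfolding poly_bounded_def by blast
  then show ?thesis unfolding pt_on_def using assms(2) outputs_within_mono by blast
qed

lemma pt_on_size:
  assumes "pt_on A f"
  obtains b where "\<And>x. x \<in> A \<Longrightarrow> size (enc (f x)) \<le> poly b (size (enc x))"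
proof -
  obtain p b where "\<forall>x\<in>A. outputs_within p (enc x) (poly b (size (enc x))) (enc (f x))"
    using assms unfolding pt_on_def by blast
  then have "\<forall>x\<in>A. size (enc (f x)) \<le> poly ([:0, 1:] + b) (size (enc x))"
    using outputs_within_size by fastforce
  then show ?thesis using that by blast
qed

lemma pt_on_Assign:
  assumes "\<And>x. x \<in> A \<Longrightarrow> enc (f x) = expr_val e ((\<lambda>_. Leaf)(0 := enc x))"
    and "\<And>x. x \<in> A \<Longrightarrow> size (enc (f x)) \<le> k + size (enc x)"
  shows "pt_on A f"
proof (rule pt_onI)
  show "poly_bounded (\<lambda>n. 1 + (k + n))" by (intro pb_intros)
next
  fix x assume "x \<in> A"
  then show "outputs_within (Assign 0 e) (enc x) (1 + (k + size (enc x))) (enc (f x))"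
    unfolding outputs_within_runs using assms
    by (intro runs_mono[OF runs_Assign[of "\<lambda>s. s 0 = enc (f x)"]]) auto
qed

lemma size_left: "size (left t) \<le> size t" and size_right: "size (right t) \<le> size t"
  by (cases t; simp)+

lemma pt_on_id [pt_intros]: "pt_on A (\<lambda>x. x)"
  by (rule pt_on_Assign[where e = "VarE 0"]) auto

section \<open>Closure under composition, pairing and case distinction\<close>

lemma pt_on_comp:
  assumes "pt_on B g" "pt_on A f" "f ` A \<subseteq> B"
  shows "pt_on A (\<lambda>x. g (f x))"
proof -
  obtain p b where p: "\<And>x. x\<in>A \<Longrightarrow> outputs_within p (enc x) (poly b (size (enc x))) (enc (f x))"
    using assms(2) unfolding pt_on_def by blast
  obtain q c where q: "\<And>x. x\<in>B \<Longrightarrow> outputs_within q (enc x) (poly c (size (enc x))) (enc (g x))"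
    using assms(1) unfolding pt_on_def by blast
  obtain d where d: "\<And>x. x\<in>A \<Longrightarrow> size (enc (f x)) \<le> poly d (size (enc x))"
    using pt_on_size[OF assms(2)] by blast
  let ?h = "\<lambda>n. (com_bound p + 2 * (n + poly b n) + 3) + (com_bound q + 2 * (poly d n + poly c (poly d n)) + 3)"
  show ?thesis
  proof (rule pt_onI)
    show "poly_bounded ?h" by (intro pb_intros)
  next
    fix x assume x: "x \<in> A"
    show "outputs_within (Seq (call 2 p 0 1) (call 2 q 1 0)) (enc x) (?h (size (enc x))) (enc (g (f x)))"
      unfolding outputs_within_runs
    proof (rule runs_Seq, rule runs_mono)
      show "runs (call 2 p 0 1) ((\<lambda>_. Leaf)(0 := enc x)) (com_bound p + 2 * (size (enc x) + poly b (size (enc x))) + 3)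
        (\<lambda>s'. s' 1 = enc (f x))"
        by (rule runs_mono[OF runs_call]) (use p[OF x] in auto)
    next
      fix s' :: state assume s': "s' 1 = enc (f x)"
      have "outputs_within q (s' 1) (poly c (poly d (size (enc x)))) (enc (g (f x)))"
        unfolding s' using assms(3) x
        by (intro outputs_within_mono[OF q] poly_nat_mono d) auto
      from runs_call[where s = s', OF this, of 2 0]
      show "runs (call 2 q 1 0) s' (com_bound q + 2 * (poly d (size (enc x)) + poly c (poly d (size (enc x)))) + 3)
         (\<lambda>s. s 0 = enc (g (f x)))"
        by (rule runs_mono) (use d[OF x] s' in auto)
    qed auto
  qed
qed

lemma pt_comp: "pt g \<Longrightarrow> pt_on A f \<Longrightarrow> pt_on A (\<lambda>x. g (f x))"
  by (rule pt_on_comp) auto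

text \<open>One rule for everything encoded as a binary node: pairs, list cells and tagged
  symbols.\<close>

lemma pt_on_tree2:
  assumes "pt_on A f" "pt_on A g" "\<And>x. x \<in> A \<Longrightarrow> enc (h x) = Node (enc (f x)) (enc (g x))"
  shows "pt_on A h"
proof -
  obtain p b where p: "\<And>x. x\<in>A \<Longrightarrow> outputs_within p (enc x) (poly b (size (enc x))) (enc (f x))"
    using assms(1) unfolding pt_on_def by blast
  obtain q c where q: "\<And>x. x\<in>A \<Longrightarrow> outputs_within q (enc x) (poly c (size (enc x))) (enc (g x))"
    using assms(2) unfolding pt_on_def by blast
  let ?h = "\<lambda>n. (com_bound p + 2 * (n + poly b n) + 3) + ((com_bound q + 2 * (n + poly c n) + 3)
     + (2 + (n + poly b n) + (n + poly c n)))"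
  show ?thesis
  proof (rule pt_onI)
    show "poly_bounded ?h" by (intro pb_intros)
  next
    fix x assume x: "x \<in> A"
    let ?n = "size (enc x)"
    show "outputs_within (Seq (call 3 p 0 1) (Seq (call 3 q 0 2) (Assign 0 (NodeE 1 2)))) (enc x) (?h ?n) (enc (h x))"
      unfolding outputs_within_runs
    proof (rule runs_Seq)
      show "runs (call 3 p 0 1) ((\<lambda>_. Leaf)(0 := enc x)) (com_bound p + 2 * (?n + poly b ?n) + 3)
        (\<lambda>s. s 0 = enc x \<and> s 1 = enc (f x))"
        by (rule runs_mono[OF runs_call]) (use p[OF x] in auto)
    next
      fix s :: state assume s: "s 0 = enc x \<and> s 1 = enc (f x)"
      show "runs (Seq (call 3 q 0 2) (Assign 0 (NodeE 1 2))) s ((com_bound q + 2 * (?n + poly c ?n) + 3)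
     + (2 + (?n + poly b ?n) + (?n + poly c ?n))) (\<lambda>s. s 0 = enc (h x))"
      proof (rule runs_Seq)
        show "runs (call 3 q 0 2) s (com_bound q + 2 * (?n + poly c ?n) + 3)
          (\<lambda>s. s 1 = enc (f x) \<and> s 2 = enc (g x))"
          by (rule runs_mono[OF runs_call[where r = "enc (g x)"]]) (use q[OF x] s in auto)
      next
        fix s' :: state assume "s' 1 = enc (f x) \<and> s' 2 = enc (g x)"
        then show "runs (Assign 0 (NodeE 1 2)) s' (2 + (?n + poly b ?n) + (?n + poly c ?n)) (\<lambda>s. s 0 = enc (h x))"
          using outputs_within_size[OF p[OF x]] outputs_within_size[OF q[OF x]] assms(3)[OF x]
          by (intro runs_mono[OF runs_Assign[where Q = "\<lambda>s. s 0 = enc (h x)"]]) auto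
      qed
    qed
  qed
qed

lemma pt_on_Pair [pt_intros]: "pt_on A f \<Longrightarrow> pt_on A g \<Longrightarrow> pt_on A (\<lambda>x. (f x, g x))"
  and pt_on_Cons [pt_intros]: "pt_on A f \<Longrightarrow> pt_on A fs \<Longrightarrow> pt_on A (\<lambda>x. f x # fs x)"
  by (erule (1) pt_on_tree2, simp)+

text \<open>The tested value may have any type; as a list is empty iff its encoding is
  \<open>Leaf\<close>, this covers emptiness tests as well as booleans.\<close>

lemma pt_on_if_Leaf:
  assumes "pt_on A c" "\<And>x. x \<in> A \<Longrightarrow> P x \<longleftrightarrow> enc (c x) \<noteq> Leaf"
    and "pt_on A f" "pt_on A g"
  shows "pt_on A (\<lambda>x. if P x then f x else g x)"
proof -
  obtain p b where p: "\<And>x. x\<in>A \<Longrightarrow> outputs_within p (enc x) (poly b (size (enc x))) (enc (c x))"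
    using assms(1) unfolding pt_on_def by blast
  obtain q e where q: "\<And>x. x\<in>A \<Longrightarrow> outputs_within q (enc x) (poly e (size (enc x))) (enc (f x))"
    using assms(3) unfolding pt_on_def by blast
  obtain r d where r: "\<And>x. x\<in>A \<Longrightarrow> outputs_within r (enc x) (poly d (size (enc x))) (enc (g x))"
    using assms(4) unfolding pt_on_def by blast
  let ?T1 = "\<lambda>n. com_bound q + 2 * (n + poly e n) + 3"
  let ?T2 = "\<lambda>n. com_bound r + 2 * (n + poly d n) + 3"
  let ?h = "\<lambda>n. (com_bound p + 2 * (n + poly b n) + 3) + (1 + (?T1 n + ?T2 n))"
  show ?thesis
  proof (rule pt_onI)
    show "poly_bounded ?h" by (intro pb_intros)
  next
    fix x assume x: "x \<in> A"
    let ?n = "size (enc x)"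
    let ?res = "enc (if P x then f x else g x)"
    show "outputs_within (Seq (call 2 p 0 1) (IfNode 1 (call 2 q 0 0) (call 2 r 0 0))) (enc x) (?h ?n) ?res"
      unfolding outputs_within_runs
    proof (rule runs_Seq)
      show "runs (call 2 p 0 1) ((\<lambda>_. Leaf)(0 := enc x)) (com_bound p + 2 * (?n + poly b ?n) + 3)
        (\<lambda>s. s 0 = enc x \<and> s 1 = enc (c x))"
        by (rule runs_mono[OF runs_call]) (use p[OF x] in auto)
    next
      fix s :: state assume s: "s 0 = enc x \<and> s 1 = enc (c x)"
      show "runs (IfNode 1 (call 2 q 0 0) (call 2 r 0 0)) s (1 + (?T1 ?n + ?T2 ?n)) (\<lambda>s. s 0 = ?res)"
      proof (rule runs_If)
        assume "s 1 \<noteq> Leaf"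
        then have "P x" using s assms(2)[OF x] by auto
        then show "runs (call 2 q 0 0) s (?T1 ?n + ?T2 ?n) (\<lambda>s. s 0 = ?res)"
          by (intro runs_mono[OF runs_call[where r = "enc (f x)"]]) (use q[OF x] s in auto)
      next
        assume "s 1 = Leaf"
        then have "\<not> P x" using s assms(2)[OF x] by auto
        then show "runs (call 2 r 0 0) s (?T1 ?n + ?T2 ?n) (\<lambda>s. s 0 = ?res)"
          by (intro runs_mono[OF runs_call[where r = "enc (g x)"]]) (use r[OF x] s in auto)
      qed
    qed
  qed
qed

lemma pt_on_if [pt_intros]:
  "pt_on A P \<Longrightarrow> pt_on A f \<Longrightarrow> pt_on A g \<Longrightarrow> pt_on A (\<lambda>x. if P x then f x else g x)"
  by (erule pt_on_if_Leaf) (auto simp: enc_bool_def)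

lemma pt_on_expr:
  assumes "pt_on A f" "\<And>x s. x \<in> A \<Longrightarrow> s 0 = enc (f x) \<Longrightarrow> expr_val e s = enc (g x)"
    and "\<And>x. x \<in> A \<Longrightarrow> size (enc (g x)) \<le> k + size (enc (f x))"
  shows "pt_on A g"
proof -
  obtain p b where p: "\<And>x. x\<in>A \<Longrightarrow> outputs_within p (enc x) (poly b (size (enc x))) (enc (f x))"
    using assms(1) unfolding pt_on_def by blast
  let ?h = "\<lambda>n. poly b n + (1 + (k + (n + poly b n)))"
  show ?thesis
  proof (rule pt_onI)
    show "poly_bounded ?h" by (intro pb_intros)
  next
    fix x assume x: "x \<in> A"
    let ?n = "size (enc x)"
    show "outputs_within (Seq p (Assign 0 e)) (enc x) (?h ?n) (enc (g x))"
      unfolding outputs_within_runs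
    proof (rule runs_Seq)
      show "runs p ((\<lambda>_. Leaf)(0 := enc x)) (poly b ?n) (\<lambda>s. s 0 = enc (f x))"
        using p[OF x] unfolding outputs_within_runs .
    next
      fix s :: state assume "s 0 = enc (f x)"
      then have "expr_val e s = enc (g x)" using assms(2) x by blast
      then show "runs (Assign 0 e) s (1 + (k + (?n + poly b ?n))) (\<lambda>s. s 0 = enc (g x))"
        using outputs_within_size[OF p[OF x]] assms(3)[OF x]
        by (intro runs_mono[OF runs_Assign[where Q = "\<lambda>s. s 0 = enc (g x)"]]) auto
    qed
  qed
qed

lemma pt_on_left:
  assumes "pt_on A f" "\<And>x. x \<in> A \<Longrightarrow> enc (g x) = left (enc (f x))"
  shows "pt_on A g"
  by (rule pt_on_expr[OF assms(1), where e = "LeftE 0" and k = 0]) (use assms(2) size_left in auto)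

lemma pt_on_right:
  assumes "pt_on A f" "\<And>x. x \<in> A \<Longrightarrow> enc (g x) = right (enc (f x))"
  shows "pt_on A g"
  by (rule pt_on_expr[OF assms(1), where e = "RightE 0" and k = 0]) (use assms(2) size_right in auto)

text \<open>Programs see only encodings, so a value may be reread at another type, as with a number
  and its list of bits.\<close>

lemma pt_on_coerce:
  assumes "pt_on A f" "\<And>x. x \<in> A \<Longrightarrow> enc (g x) = enc (f x)"
  shows "pt_on A g"
  by (rule pt_on_expr[OF assms(1), where e = "VarE 0" and k = 0]) (use assms(2) in auto)

lemma pt_on_fst [pt_intros]: "pt_on A f \<Longrightarrow> pt_on A (\<lambda>x. fst (f x))"
  by (erule pt_on_left) (simp add: enc_prod_def)

lemma pt_on_snd [pt_intros]: "pt_on A f \<Longrightarrow> pt_on A (\<lambda>x. snd (f x))"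
  by (erule pt_on_right) (simp add: enc_prod_def)

lemma pt_on_tl [pt_intros]: "pt_on A f \<Longrightarrow> pt_on A (\<lambda>x. tl (f x))"
proof (erule pt_on_right)
  fix x show "enc (tl (f x)) = right (enc (f x))" by (cases "f x") simp_all
qed

text \<open>Trees encode themselves; a constant of any type is then built by induction on its
  encoding.\<close>

instantiation tree :: enc
begin
definition enc_tree_def [simp]: "enc (t :: tree) = t"
instance ..
end

lemma pt_on_const [pt_intros]: "pt_on A (\<lambda>_. c)"
proof -
  have "pt_on A (\<lambda>_. t)" for t :: tree
  proof (induction t)
    case Leaf
    show ?case by (rule pt_on_expr[OF pt_on_id, where e = LeafE]) auto
  next
    case (Node l r)
    then show ?case by (rule pt_on_tree2) simp
  qed
  from this[of "enc c"] show ?thesis by (rule pt_on_coerce) simp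
qed

lemma pt_on_Nil_eq [pt_intros]:
  assumes "pt_on A f"
  shows "pt_on A (\<lambda>x. f x = [])"
proof -
  have "pt_on A (\<lambda>x. if f x \<noteq> [] then False else True)"
  proof (rule pt_on_if_Leaf[OF assms])
    show "(f x \<noteq> []) = (enc (f x) \<noteq> Leaf)" for x by (cases "f x") auto
  qed (intro pt_intros)+
  then show ?thesis by (rule pt_on_coerce) simp
qed

lemma pt_on_not [pt_intros]:
  assumes "pt_on A P"
  shows "pt_on A (\<lambda>x. \<not> P x)"
proof -
  have "pt_on A (\<lambda>x. if P x then False else True)" by (intro pt_intros assms)
  then show ?thesis by (rule pt_on_coerce) simp
qed

lemma pt_on_conj [pt_intros]:
  assumes "pt_on A P" "pt_on A Q"
  shows "pt_on A (\<lambda>x. P x \<and> Q x)"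
proof -
  have "pt_on A (\<lambda>x. if P x then Q x else False)" by (intro pt_intros assms)
  then show ?thesis by (rule pt_on_coerce) simp
qed

section \<open>Folding over lists\<close>

lemma length_le_size_enc: "length xs \<le> size (enc xs)"
  by (induction xs) auto

lemma size_enc_append: "size (enc (xs @ ys)) = size (enc xs) + size (enc ys)"
  by (induction xs) auto

text \<open>The bound \<open>h\<close> on the result of every prefix prevents the sizes from
  compounding. The argument \<open>c\<close> is the environment of the step: programs have no
  closures, so it is passed along as data.\<close>

lemma pt_on_fold:
  fixes f :: "'c :: enc \<Rightarrow> 'x :: enc \<Rightarrow> 's :: enc \<Rightarrow> 's"
  assumes f: "pt (\<lambda>p. f (fst p) (fst (snd p)) (snd (snd p)))"
    and c: "pt_on A c" and xs: "pt_on A xs" and i: "pt_on A i"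
    and B: "poly_bounded h"
      "\<And>a ys zs. a \<in> A \<Longrightarrow> xs a = ys @ zs \<Longrightarrow>
         size (enc (fold (f (c a)) ys (i a))) \<le> h (size (enc a))"
  shows "pt_on A (\<lambda>a. fold (f (c a)) (xs a) (i a))"
proof -
  obtain p b where "\<And>q. outputs_within p (enc q) (poly b (size (enc q)))
      (enc (f (fst q) (fst (snd q)) (snd (snd q))))"
    using f unfolding pt_on_def by blast
  then have p: "outputs_within p (Node (enc c) (Node (enc x) (enc s)))
      (poly b (size (Node (enc c) (Node (enc x) (enc s))))) (enc (f c x s))" for c x s
    by (metis enc_simps(3) fst_conv snd_conv)
  define K :: "nat \<Rightarrow> nat" where
    "K = (\<lambda>n. (1 + n) + ((1 + (2 * n + 1)) + ((1 + (3 * n + 2)) +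
        ((com_bound p + 2 * ((3 * n + 2) + poly b (3 * n + 2)) + 3) + (1 + n)))))"
  \<comment> \<open>Register 1 holds the environment, 2 the unread list and 3 the accumulator; 4 to
    6 assemble the argument of \<open>p\<close>.\<close>
  define body where "body = Seq (Assign 4 (LeftE 2)) (Seq (Assign 5 (NodeE 4 3)) (Seq (Assign 6 (NodeE 1 5))
      (Seq (call 7 p 6 3) (Assign 2 (RightE 2)))))"
  have body: "runs body s (K n) (\<lambda>s'. s' 1 = enc c \<and> s' 2 = enc xs \<and> s' 3 = enc (f c x a))"
    if s: "s 1 = enc c" "s 2 = enc (x # xs)" "s 3 = enc a"
      and n: "size (enc c) \<le> n" "size (enc (x # xs)) \<le> n" "size (enc a) \<le> n"
    for s :: state and c x xs a n
  proof -
    let ?s1 = "s(4 := enc x)" let ?s2 = "?s1(5 := Node (enc x) (enc a))"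
    let ?s3 = "?s2(6 := Node (enc c) (Node (enc x) (enc a)))"
    have sz: "size (Node (enc c) (Node (enc x) (enc a))) \<le> 3 * n + 2"
      using n by simp
    have 1: "runs (Assign 4 (LeftE 2)) s (1 + n) (\<lambda>s'. s' = ?s1)"
      using s n by (intro runs_mono[OF runs_Assign[where Q = "\<lambda>s'. s' = ?s1"]]) auto
    have 2: "runs (Assign 5 (NodeE 4 3)) ?s1 (1 + (2 * n + 1)) (\<lambda>s'. s' = ?s2)"
      using s n by (intro runs_mono[OF runs_Assign[where Q = "\<lambda>s'. s' = ?s2"]]) auto
    have 3: "runs (Assign 6 (NodeE 1 5)) ?s2 (1 + (3 * n + 2)) (\<lambda>s'. s' = ?s3)"
      using s n by (intro runs_mono[OF runs_Assign[where Q = "\<lambda>s'. s' = ?s3"]]) auto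
    have "outputs_within p (?s3 6) (poly b (3 * n + 2)) (enc (f c x a))"
      using outputs_within_mono[OF p poly_nat_mono[OF sz]] by simp
    from runs_call[where s = ?s3, OF this, of 7 3]
    have 4: "runs (call 7 p 6 3) ?s3 (com_bound p + 2 * ((3 * n + 2) + poly b (3 * n + 2)) + 3)
       (\<lambda>s'. s' 1 = enc c \<and> s' 2 = enc (x # xs) \<and> s' 3 = enc (f c x a))"
      by (rule runs_mono) (use s sz in auto)
    have 5: "runs (Assign 2 (RightE 2)) s' (1 + n) (\<lambda>s'. s' 1 = enc c \<and> s' 2 = enc xs \<and> s' 3 = enc (f c x a))"
      if "s' 1 = enc c \<and> s' 2 = enc (x # xs) \<and> s' 3 = enc (f c x a)" for s'
      using that n by (intro runs_mono[OF runs_Assign[where Q = "\<lambda>s'. s' 1 = enc c \<and> s' 2 = enc xs \<and> s' 3 = enc (f c x a)"]]) auto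
    show ?thesis unfolding body_def K_def
      by (rule runs_Seq[OF 1], simp only: , rule runs_Seq[OF 2], simp only: ,
          rule runs_Seq[OF 3], simp only: , rule runs_Seq[OF 4], rule 5)
  qed
  have loop: "runs (WhileNode 2 body) s (length zs * (1 + K n) + 1) (\<lambda>s'. s' 3 = enc (fold (f c) (ys @ zs) a))"
    if "s 1 = enc c" "s 2 = enc zs" "s 3 = enc (fold (f c) ys a)"
      "size (enc c) \<le> n" "size (enc zs) \<le> n"
      "\<And>ys' zs'. ys @ zs = ys' @ zs' \<Longrightarrow> size (enc (fold (f c) ys' a)) \<le> n"
    for s :: state and c zs ys a n
    using that
  proof (induction zs arbitrary: s ys)
    case Nil
    then show ?case using runs_While_False[of s 2] by simp
  next
    case (Cons z zs)
    have "runs (WhileNode 2 body) s (1 + K n + (length zs * (1 + K n) + 1))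
      (\<lambda>s'. s' 3 = enc (fold (f c) (ys @ z # zs) a))"
    proof (rule runs_While_True)
      show "s 2 \<noteq> Leaf" using Cons.prems by simp
      show "runs body s (K n) (\<lambda>s'. s' 1 = enc c \<and> s' 2 = enc zs \<and> s' 3 = enc (f c z (fold (f c) ys a)))"
        by (rule body) (use Cons.prems in auto)
    next
      fix s' :: state assume s': "s' 1 = enc c \<and> s' 2 = enc zs \<and> s' 3 = enc (f c z (fold (f c) ys a))"
      have "runs (WhileNode 2 body) s' (length zs * (1 + K n) + 1)
        (\<lambda>s'. s' 3 = enc (fold (f c) ((ys @ [z]) @ zs) a))"
        by (rule Cons.IH) (use s' Cons.prems in auto)
      then show "runs (WhileNode 2 body) s' (length zs * (1 + K n) + 1)
        (\<lambda>s'. s' 3 = enc (fold (f c) (ys @ z # zs) a))" by simp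
    qed
    then show ?case by (simp add: algebra_simps)
  qed
  obtain p1 b1 where p1: "\<And>x. x\<in>A \<Longrightarrow> outputs_within p1 (enc x) (poly b1 (size (enc x))) (enc (c x))"
    using c unfolding pt_on_def by blast
  obtain p2 b2 where p2: "\<And>x. x\<in>A \<Longrightarrow> outputs_within p2 (enc x) (poly b2 (size (enc x))) (enc (xs x))"
    using xs unfolding pt_on_def by blast
  obtain p3 b3 where p3: "\<And>x. x\<in>A \<Longrightarrow> outputs_within p3 (enc x) (poly b3 (size (enc x))) (enc (i x))"
    using i unfolding pt_on_def by blast
  obtain b4 where b4: "\<And>n. h n \<le> poly b4 n" using B(1) unfolding poly_bounded_def by blast
  define N where "N = (\<lambda>n. (n + poly b1 n) + ((n + poly b2 n) + poly b4 n))"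
  let ?C = "\<lambda>p b n. com_bound p + 2 * (n + poly b n) + 3"
  define H where "H = (\<lambda>n. ?C p1 b1 n + (?C p2 b2 n + (?C p3 b3 n + ((N n * (1 + K (N n)) + 1) + (1 + N n)))))"
  show ?thesis
  proof (rule pt_onI)
    show "poly_bounded H" unfolding H_def N_def K_def by (intro pb_intros)
  next
    fix a assume a: "a \<in> A"
    let ?n = "size (enc a)"
    let ?r = "enc (fold (f (c a)) (xs a) (i a))"
    have sc: "size (enc (c a)) \<le> N ?n" and sx: "size (enc (xs a)) \<le> N ?n"
      using outputs_within_size[OF p1[OF a]] outputs_within_size[OF p2[OF a]] unfolding N_def by auto
    have sf: "size (enc (fold (f (c a)) ys (i a))) \<le> N ?n" if "xs a = ys @ zs" for ys zs
      using B(2)[OF a that] b4[of ?n] unfolding N_def by simp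
    have sr: "size ?r \<le> N ?n" using sf[of "xs a" "[]"] by simp
    show "outputs_within (Seq (call 7 p1 0 1) (Seq (call 7 p2 0 2) (Seq (call 7 p3 0 3)
       (Seq (WhileNode 2 body) (Assign 0 (VarE 3)))))) (enc a) (H ?n) ?r"
      unfolding outputs_within_runs H_def
    proof (rule runs_Seq)
      show "runs (call 7 p1 0 1) ((\<lambda>_. Leaf)(0 := enc a)) (?C p1 b1 ?n) (\<lambda>s. s 0 = enc a \<and> s 1 = enc (c a))"
        by (rule runs_mono[OF runs_call[where r = "enc (c a)"]]) (use p1[OF a] in auto)
      fix s1 :: state assume s1: "s1 0 = enc a \<and> s1 1 = enc (c a)"
      show "runs (Seq (call 7 p2 0 2) (Seq (call 7 p3 0 3) (Seq (WhileNode 2 body) (Assign 0 (VarE 3))))) s1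
        (?C p2 b2 ?n + (?C p3 b3 ?n + ((N ?n * (1 + K (N ?n)) + 1) + (1 + N ?n)))) (\<lambda>s. s 0 = ?r)"
      proof (rule runs_Seq)
        show "runs (call 7 p2 0 2) s1 (?C p2 b2 ?n) (\<lambda>s. s 0 = enc a \<and> s 1 = enc (c a) \<and> s 2 = enc (xs a))"
          by (rule runs_mono[OF runs_call[where r = "enc (xs a)"]]) (use p2[OF a] s1 in auto)
        fix s2 :: state assume s2: "s2 0 = enc a \<and> s2 1 = enc (c a) \<and> s2 2 = enc (xs a)"
        show "runs (Seq (call 7 p3 0 3) (Seq (WhileNode 2 body) (Assign 0 (VarE 3)))) s2
          (?C p3 b3 ?n + ((N ?n * (1 + K (N ?n)) + 1) + (1 + N ?n))) (\<lambda>s. s 0 = ?r)"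
        proof (rule runs_Seq)
          show "runs (call 7 p3 0 3) s2 (?C p3 b3 ?n)
            (\<lambda>s. s 1 = enc (c a) \<and> s 2 = enc (xs a) \<and> s 3 = enc (i a))"
            by (rule runs_mono[OF runs_call[where r = "enc (i a)"]]) (use p3[OF a] s2 in auto)
          fix s3 :: state assume s3: "s3 1 = enc (c a) \<and> s3 2 = enc (xs a) \<and> s3 3 = enc (i a)"
          show "runs (Seq (WhileNode 2 body) (Assign 0 (VarE 3))) s3
            ((N ?n * (1 + K (N ?n)) + 1) + (1 + N ?n)) (\<lambda>s. s 0 = ?r)"
          proof (rule runs_Seq)
            have "runs (WhileNode 2 body) s3 (length (xs a) * (1 + K (N ?n)) + 1)
              (\<lambda>s'. s' 3 = enc (fold (f (c a)) ([] @ xs a) (i a)))"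
              by (rule loop) (use s3 sc sx sf in auto)
            moreover have "length (xs a) * (1 + K (N ?n)) + 1 \<le> N ?n * (1 + K (N ?n)) + 1"
              using length_le_size_enc[of "xs a"] sx by (intro add_right_mono mult_right_mono) auto
            ultimately show "runs (WhileNode 2 body) s3 (N ?n * (1 + K (N ?n)) + 1) (\<lambda>s. s 3 = ?r)"
              by (rule runs_mono) auto
            fix s4 :: state assume "s4 3 = ?r"
            then show "runs (Assign 0 (VarE 3)) s4 (1 + N ?n) (\<lambda>s. s 0 = ?r)"
              using sr by (intro runs_mono[OF runs_Assign[where Q = "\<lambda>s. s 0 = ?r"]]) auto
          qed
        qed
      qed
    qed
  qed
qed

text \<open>If the growth in one step depends only on the environment and the list entry, the total
  growth is at most the number of entries times a polynomial.\<close>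

lemma pt_on_fold_add:
  fixes f :: "'c :: enc \<Rightarrow> 'x :: enc \<Rightarrow> 's :: enc \<Rightarrow> 's"
  assumes f: "pt (\<lambda>p. f (fst p) (fst (snd p)) (snd (snd p)))"
    and c: "pt_on A c" and xs: "pt_on A xs" and i: "pt_on A i"
    and B: "\<And>c x s. size (enc (f c x s)) \<le> size (enc s) + poly q (size (enc c) + size (enc x))"
  shows "pt_on A (\<lambda>a. fold (f (c a)) (xs a) (i a))"
proof -
  obtain b1 where b1: "\<And>x. x \<in> A \<Longrightarrow> size (enc (c x)) \<le> poly b1 (size (enc x))"
    using pt_on_size[OF c] by blast
  obtain b2 where b2: "\<And>x. x \<in> A \<Longrightarrow> size (enc (xs x)) \<le> poly b2 (size (enc x))"
    using pt_on_size[OF xs] by blast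
  obtain b3 where b3: "\<And>x. x \<in> A \<Longrightarrow> size (enc (i x)) \<le> poly b3 (size (enc x))"
    using pt_on_size[OF i] by blast
  let ?h = "\<lambda>n. poly b3 n + poly b2 n * poly q (poly b1 n + poly b2 n)"
  show ?thesis
  proof (rule pt_on_fold[OF f c xs i])
    show "poly_bounded ?h" by (intro pb_intros)
    fix a ys zs assume a: "a \<in> A" "xs a = ys @ zs"
    have fold: "size (enc (fold (f c) ys s)) \<le> size (enc s) + length ys * poly q (size (enc c) + n)"
      if "\<forall>y\<in>set ys. size (enc y) \<le> n" for c ys s n
      using that
    proof (induction ys arbitrary: s)
      case (Cons y ys)
      have "size (enc (fold (f c) (y # ys) s)) \<le> size (enc (f c y s)) + length ys * poly q (size (enc c) + n)"
        using Cons by simp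
      also have "size (enc (f c y s)) \<le> size (enc s) + poly q (size (enc c) + size (enc y))" by (rule B)
      also have "poly q (size (enc c) + size (enc y)) \<le> poly q (size (enc c) + n)"
        using Cons.prems by (intro poly_nat_mono) auto
      finally show ?case by simp
    qed simp
    have mem: "size (enc y) \<le> size (enc ys)" if "y \<in> set ys" for y :: 'x and ys
      using that by (induction ys) auto
    have "size (enc (fold (f (c a)) ys (i a))) \<le>
      size (enc (i a)) + length ys * poly q (size (enc (c a)) + size (enc ys))"
      by (rule fold) (use mem in blast)
    also have "\<dots> \<le> ?h (size (enc a))"
    proof (rule add_mono[OF b3[OF a(1)]], rule mult_mono)
      have *: "size (enc ys) \<le> poly b2 (size (enc a))"
        using b2[OF a(1)] a(2) by (simp add: size_enc_append)
      then show "length ys \<le> poly b2 (size (enc a))"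
        using length_le_size_enc[of ys] by simp
      show "poly q (size (enc (c a)) + size (enc ys)) \<le>
        poly q (poly b1 (size (enc a)) + poly b2 (size (enc a)))"
        by (rule poly_nat_mono, rule add_mono[OF b1[OF a(1)] *])
    qed auto
    finally show "size (enc (fold (f (c a)) ys (i a))) \<le> ?h (size (enc a))" .
  qed
qed


section \<open>Values of straight-line programs\<close>

fun sym_val :: "(nat \<Rightarrow> nat list) \<Rightarrow> sym \<Rightarrow> nat list" where
  "sym_val v (NT A) = v A"
| "sym_val v (Tm a) = [a]"

definition rhs_val :: "(nat \<Rightarrow> nat list) \<Rightarrow> sym list \<Rightarrow> nat list" where
  "rhs_val v \<alpha> = concat (map (sym_val v) \<alpha>)"

lemma rhs_val_simps [simp]:
  "rhs_val v [] = []"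
  "rhs_val v (X # \<alpha>) = sym_val v X @ rhs_val v \<alpha>"
  "rhs_val v (\<alpha> @ \<beta>) = rhs_val v \<alpha> @ rhs_val v \<beta>"
  by (simp_all add: rhs_val_def)

lemma rhs_val_map_Tm [simp]: "rhs_val v (map Tm w) = w"
  by (induction w) auto

lemma rhs_val_cong:
  "(\<And>A. NT A \<in> set \<alpha> \<Longrightarrow> u A = v A) \<Longrightarrow> rhs_val u \<alpha> = rhs_val v \<alpha>"
proof (induction \<alpha>)
  case (Cons X \<alpha>)
  then show ?case by (cases X) auto
qed simp

section \<open>Ranking the nonterminals along the acyclic relation\<close>

definition nt_edges :: "grammar \<Rightarrow> (nat \<times> nat) set" where
  "nt_edges G = {(A, B). A \<in> nonterminals G \<and> B \<in> nonterminals G \<and>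
                      (\<exists>\<alpha>. (A, \<alpha>) \<in> productions G \<and> NT B \<in> set \<alpha>)}"

lemma acyclicI_measure:
  fixes f :: "'a \<Rightarrow> nat"
  assumes "\<And>a b. (a, b) \<in> r \<Longrightarrow> f b < f a"
  shows "acyclic r"
proof -
  have "r\<inverse> \<subseteq> measure f" using assms by auto
  then have "wf (r\<inverse>)" using wf_measure wf_subset by blast
  then show ?thesis using wf_acyclic acyclic_converse by blast
qed

lemma slpD:
  assumes "slp G"
  shows "finite (nonterminals G)" "finite (productions G)" "start G \<in> nonterminals G"
    "\<And>A \<alpha>. (A, \<alpha>) \<in> productions G \<Longrightarrow> A \<in> nonterminals G"
    "\<And>A \<alpha>. (A, \<alpha>) \<in> productions G \<Longrightarrow> \<alpha> \<noteq> []"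
    "\<And>A B \<alpha>. (A, \<alpha>) \<in> productions G \<Longrightarrow> NT B \<in> set \<alpha> \<Longrightarrow> B \<in> nonterminals G"
    "\<And>A \<alpha> \<beta>. (A, \<alpha>) \<in> productions G \<Longrightarrow> (A, \<beta>) \<in> productions G \<Longrightarrow> \<alpha> = \<beta>"
    "\<And>A. A \<in> nonterminals G \<Longrightarrow> \<exists>\<alpha>. (A, \<alpha>) \<in> productions G"
    "acyclic (nt_edges G)"
proof -
  obtain \<Sigma> where "slp_over \<Sigma> G" using assms unfolding slp_def by blast
  then have fin: "finite (nonterminals G)" "finite (productions G)" "start G \<in> nonterminals G"
    and wf': "\<forall>(A, \<alpha>) \<in> productions G.
        A \<in> nonterminals G \<and> \<alpha> \<noteq> [] \<and> set \<alpha> \<subseteq> NT ` nonterminals G \<union> Tm ` \<Sigma>"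
    and ex1': "\<forall>A \<in> nonterminals G. \<exists>!\<alpha>. (A, \<alpha>) \<in> productions G"
    and acyc: "acyclic (nt_edges G)"
    unfolding slp_over_def nt_edges_def by simp_all
  show "finite (nonterminals G)" "finite (productions G)" "start G \<in> nonterminals G"
    "acyclic (nt_edges G)"
    by (fact fin acyc)+
  have ex1: "\<exists>!\<alpha>. (A, \<alpha>) \<in> productions G" if "A \<in> nonterminals G" for A
    using ex1' that by simp
  have wf: "A \<in> nonterminals G \<and> \<alpha> \<noteq> [] \<and> set \<alpha> \<subseteq> NT ` nonterminals G \<union> Tm ` \<Sigma>"
    if "(A, \<alpha>) \<in> productions G" for A \<alpha>
    using wf' that by auto
  show "A \<in> nonterminals G" "\<alpha> \<noteq> []" if "(A, \<alpha>) \<in> productions G" for A \<alpha>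
    using wf[OF that] by blast+
  show "B \<in> nonterminals G" if "(A, \<alpha>) \<in> productions G" "NT B \<in> set \<alpha>" for A B \<alpha>
    using wf[OF that(1)] that(2) by blast
  show "\<alpha> = \<beta>" if "(A, \<alpha>) \<in> productions G" "(A, \<beta>) \<in> productions G" for A \<alpha> \<beta>
    using ex1[of A] wf that by blast
  show "\<exists>\<alpha>. (A, \<alpha>) \<in> productions G" if "A \<in> nonterminals G" for A
    using ex1[OF that] by blast
qed

text \<open>The number of nonterminals reachable from \<open>A\<close>. It decreases along
  productions, which gives induction over the grammar, and it bounds the number of rounds of a
  bottom-up computation.\<close>

definition nt_rank :: "grammar \<Rightarrow> nat \<Rightarrow> nat" where
  "nt_rank G A = card {B. (A, B) \<in> (nt_edges G)\<^sup>+}"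

lemma
  assumes "slp G"
  shows nt_rank_less: "\<And>A \<alpha> B. (A, \<alpha>) \<in> productions G \<Longrightarrow> NT B \<in> set \<alpha> \<Longrightarrow> nt_rank G B < nt_rank G A"
    and nt_rank_bound: "\<And>A. A \<in> nonterminals G \<Longrightarrow> nt_rank G A < card (nonterminals G)"
proof -
  let ?E = "nt_edges G"
  have sub: "{B. (A, B) \<in> ?E\<^sup>+} \<subseteq> nonterminals G - {A}" for A
  proof
    fix B assume "B \<in> {B. (A, B) \<in> ?E\<^sup>+}"
    then have AB: "(A, B) \<in> ?E\<^sup>+" by simp
    then have "B \<in> nonterminals G" by (induction rule: trancl.induct) (auto simp: nt_edges_def)
    moreover have "A \<noteq> B" using slpD(9)[OF assms] AB unfolding acyclic_def by blast
    ultimately show "B \<in> nonterminals G - {A}" by blast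
  qed
  have fin: "finite {B. (A, B) \<in> ?E\<^sup>+}" for A
    using sub slpD(1)[OF assms] by (meson finite_Diff finite_subset)
  show "nt_rank G B < nt_rank G A" if "(A, \<alpha>) \<in> productions G" "NT B \<in> set \<alpha>" for A \<alpha> B
    unfolding nt_rank_def
  proof (rule psubset_card_mono[OF fin])
    have AB: "(A, B) \<in> ?E" using that slpD(4,6)[OF assms] unfolding nt_edges_def by blast
    have "B \<notin> {C. (B, C) \<in> ?E\<^sup>+}" using sub[of B] by blast
    moreover have "B \<in> {C. (A, C) \<in> ?E\<^sup>+}" using AB by blast
    ultimately show "{C. (B, C) \<in> ?E\<^sup>+} \<subset> {C. (A, C) \<in> ?E\<^sup>+}"
      using trancl_into_trancl2[OF AB] by blast
  qed
  show "nt_rank G A < card (nonterminals G)" if "A \<in> nonterminals G" for A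
  proof -
    have "nt_rank G A \<le> card (nonterminals G - {A})"
      unfolding nt_rank_def using sub slpD(1)[OF assms] by (intro card_mono) auto
    also have "\<dots> < card (nonterminals G)"
      using that slpD(1)[OF assms] by (rule card_Diff1_less[rotated])
    finally show ?thesis .
  qed
qed

text \<open>Each round propagates the exact values one level up the acyclic graph of nonterminals.\<close>

lemma slp_iterate_fixpoint:
  fixes L :: "nat \<Rightarrow> nat \<Rightarrow> 'b" and F :: "(nat \<Rightarrow> 'b) \<Rightarrow> sym list \<Rightarrow> 'b"
  assumes "slp G"
    and L: "\<And>r A \<alpha>. (A, \<alpha>) \<in> productions G \<Longrightarrow> L (Suc r) A = F (L r) \<alpha>"
    and F: "\<And>f g \<alpha>. (\<And>B. NT B \<in> set \<alpha> \<Longrightarrow> f B = g B) \<Longrightarrow> F f \<alpha> = F g \<alpha>"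
    and "r \<ge> card (nonterminals G)" "(A, \<alpha>) \<in> productions G"
  shows "L r A = F (L r) \<alpha>"
proof -
  note h = nt_rank_less[OF assms(1)] nt_rank_bound[OF assms(1)]
  have stable: "L (Suc r) A = L r A" if "A \<in> nonterminals G" "nt_rank G A < r" for r A
    using that
  proof (induction r arbitrary: A)
    case (Suc r)
    obtain \<alpha> where \<alpha>: "(A, \<alpha>) \<in> productions G" using slpD(8)[OF assms(1)] Suc.prems by blast
    have "F (L (Suc r)) \<alpha> = F (L r) \<alpha>"
    proof (rule F)
      fix B assume B: "NT B \<in> set \<alpha>"
      then have "nt_rank G B < r" using h(1)[OF \<alpha> B] Suc.prems by simp
      then show "L (Suc r) B = L r B" using Suc.IH slpD(6)[OF assms(1) \<alpha> B] by blast
    qed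
    then show ?case using L[OF \<alpha>] by simp
  qed simp
  have "A \<in> nonterminals G" using slpD(4)[OF assms(1) assms(5)] .
  then have "L (Suc r) A = L r A" using stable h(2) assms(4) by (meson less_le_trans)
  then show ?thesis using L[OF assms(5)] by simp
qed

section \<open>Values as solutions of the productions read as equations\<close>

definition is_valuation :: "grammar \<Rightarrow> (nat \<Rightarrow> nat list) \<Rightarrow> bool" where
  "is_valuation G v \<longleftrightarrow> (\<forall>(A, \<alpha>) \<in> productions G. v A = rhs_val v \<alpha>)"

lemma is_valuationD: "is_valuation G v \<Longrightarrow> (A, \<alpha>) \<in> productions G \<Longrightarrow> v A = rhs_val v \<alpha>"
  unfolding is_valuation_def by blast

lemma exists_valuation:
  assumes "slp G"
  obtains v where "is_valuation G v"
proof -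
  \<comment> \<open>Bottom-up evaluation, starting from empty words everywhere.\<close>
  define L where "L = (\<lambda>r. ((\<lambda>f A. rhs_val f (THE \<alpha>. (A, \<alpha>) \<in> productions G)) ^^ r) (\<lambda>_. []))"
  have "L (card (nonterminals G)) A = rhs_val (L (card (nonterminals G))) \<alpha>"
    if "(A, \<alpha>) \<in> productions G" for A \<alpha>
  proof (rule slp_iterate_fixpoint[OF assms _ _ order_refl that])
    fix r A \<alpha> assume "(A, \<alpha>) \<in> productions G"
    then have "(THE \<alpha>. (A, \<alpha>) \<in> productions G) = \<alpha>" using slpD(7)[OF assms] by blast
    then show "L (Suc r) A = rhs_val (L r) \<alpha>" by (simp add: L_def)
  qed (rule rhs_val_cong)
  then show ?thesis using that unfolding is_valuation_def by blast
qed

lemma derives_append: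
  assumes "(derives1 G)\<^sup>*\<^sup>* x y"
  shows "(derives1 G)\<^sup>*\<^sup>* (u @ x @ w) (u @ y @ w)"
  using assms
proof (induction rule: rtranclp_induct)
  case (step y z)
  from step(2) have "derives1 G (u @ y @ w) (u @ z @ w)"
  proof cases
    case (1 A \<alpha> u' v')
    then show ?thesis using derives1.intros[of A \<alpha> G "u @ u'" "v' @ w"] by simp
  qed
  then show ?case using step by simp
qed simp

text \<open>A derivation step replaces a nonterminal by a right-hand side of equal value, so
  evaluation is invariant; this gives uniqueness of the derived word.\<close>

lemma derives_rhs_val:
  assumes "(derives1 G)\<^sup>*\<^sup>* x y" "is_valuation G v"
  shows "rhs_val v y = rhs_val v x"
  using assms
proof (induction rule: rtranclp_induct)
  case (step y z)
  from step(2) have "rhs_val v z = rhs_val v y"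
    by cases (use is_valuationD[OF step.prems] in auto)
  then show ?case using step by simp
qed simp

text \<open>From here on derivations are no longer needed: to compute the value of a program it
  suffices to exhibit a solution of its equations.\<close>

lemma nt_val_eq:
  assumes "slp G" "is_valuation G v" "A \<in> nonterminals G"
  shows "nt_val G A = v A"
  unfolding nt_val_def
proof (rule the_equality)
  note h = nt_rank_less[OF assms(1)] nt_rank_bound[OF assms(1)]
  show "(derives1 G)\<^sup>*\<^sup>* [NT A] (map Tm (v A))"
    using assms(3)
  proof (induction "nt_rank G A" arbitrary: A rule: less_induct)
    case less
    obtain \<alpha> where \<alpha>: "(A, \<alpha>) \<in> productions G" using slpD(8)[OF assms(1) less.prems] by blast
    have "(derives1 G)\<^sup>*\<^sup>* \<beta> (map Tm (rhs_val v \<beta>))" if "set \<beta> \<subseteq> set \<alpha>" for \<beta>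
      using that
    proof (induction \<beta>)
      case (Cons X \<beta>)
      have X: "(derives1 G)\<^sup>*\<^sup>* [X] (map Tm (sym_val v X))"
      proof (cases X)
        case (NT B)
        then have B: "NT B \<in> set \<alpha>" using Cons.prems by simp
        show ?thesis using less.hyps[OF h(1)[OF \<alpha> B] slpD(6)[OF assms(1) \<alpha> B]] NT by simp
      qed simp
      have "(derives1 G)\<^sup>*\<^sup>* ([] @ [X] @ \<beta>) ([] @ map Tm (sym_val v X) @ \<beta>)"
        by (rule derives_append[OF X])
      moreover have "(derives1 G)\<^sup>*\<^sup>* (map Tm (sym_val v X) @ \<beta> @ []) (map Tm (sym_val v X) @ map Tm (rhs_val v \<beta>) @ [])"
        by (rule derives_append[OF Cons.IH]) (use Cons.prems in auto)
      ultimately show ?case by simp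
    qed simp
    from this[of \<alpha>] have "(derives1 G)\<^sup>*\<^sup>* \<alpha> (map Tm (v A))"
      using is_valuationD[OF assms(2) \<alpha>] by simp
    moreover have "derives1 G [NT A] \<alpha>" using derives1.intros[OF \<alpha>, of "[]" "[]"] by simp
    ultimately show ?case by simp
  qed
  fix w assume "(derives1 G)\<^sup>*\<^sup>* [NT A] (map Tm w)"
  from derives_rhs_val[OF this assms(2)] show "w = v A" by simp
qed

lemma slp_val_eq: "slp G \<Longrightarrow> is_valuation G v \<Longrightarrow> slp_val G = v (start G)"
  unfolding slp_val_def using nt_val_eq slpD(3) by blast


section \<open>Smallest straight-line programs\<close>

lemma slp_size_pos:
  assumes "slp G"
  shows "slp_size G > 0"
proof -
  obtain \<alpha> where \<alpha>: "(start G, \<alpha>) \<in> productions G" using slpD(3,8)[OF assms] by blast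
  then have "length \<alpha> \<le> slp_size G"
    unfolding slp_size_def using slpD(2)[OF assms] member_le_sum[of "(start G, \<alpha>)" "productions G" "\<lambda>(A, \<alpha>). length \<alpha>"]
    by simp
  moreover have "length \<alpha> > 0" using slpD(5)[OF assms \<alpha>] by simp
  ultimately show ?thesis by linarith
qed

lemma smallest_slp_size_le: "slp G \<Longrightarrow> slp_val G = w \<Longrightarrow> smallest_slp_size w \<le> slp_size G"
  unfolding smallest_slp_size_def by (rule Least_le) blast

lemma smallest_slp_exists:
  assumes "slp G" "slp_val G = w"
  obtains H where "slp H" "slp_val H = w" "slp_size H = smallest_slp_size w"
proof -
  have "\<exists>H. slp H \<and> slp_val H = w \<and> slp_size H = smallest_slp_size w"
    unfolding smallest_slp_size_def by (rule LeastI[of _ "slp_size G"]) (use assms in blast)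
  then show ?thesis using that by blast
qed

text \<open>Each letter of the value is written out in some right-hand side, and a right-hand side
  contains at most its length many distinct letters.\<close>

lemma card_letters_le_slp_size:
  assumes "slp G"
  shows "card (set (slp_val G)) \<le> slp_size G"
proof -
  note h = nt_rank_less[OF assms(1)] nt_rank_bound[OF assms(1)]
  obtain v where v: "is_valuation G v" using exists_valuation[OF assms] by blast
  let ?L = "\<Union>(A, \<alpha>) \<in> productions G. {a. Tm a \<in> set \<alpha>}"
  have "set (v A) \<subseteq> ?L" if "A \<in> nonterminals G" for A
    using that
  proof (induction "nt_rank G A" arbitrary: A rule: less_induct)
    case less
    obtain \<alpha> where \<alpha>: "(A, \<alpha>) \<in> productions G" using slpD(8)[OF assms(1) less.prems] by blast
    have "set (sym_val v X) \<subseteq> ?L" if "X \<in> set \<alpha>" for X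
    proof (cases X)
      case (NT B)
      then have B: "NT B \<in> set \<alpha>" using that by simp
      show ?thesis using less.hyps[OF h(1)[OF \<alpha> B] slpD(6)[OF assms(1) \<alpha> B]] NT by simp
    next
      case (Tm a)
      then show ?thesis using \<alpha> that by auto
    qed
    then show ?case using is_valuationD[OF v \<alpha>] by (auto simp: rhs_val_def)
  qed
  then have "set (slp_val G) \<subseteq> ?L" using slp_val_eq[OF assms v] slpD(3)[OF assms] by simp
  have fin: "finite {a. Tm a \<in> set \<alpha>} \<and> card {a. Tm a \<in> set \<alpha>} \<le> length \<alpha>" for \<alpha>
  proof -
    have eq: "Tm ` {a. Tm a \<in> set \<alpha>} \<subseteq> set \<alpha>" by auto
    have inj: "inj_on Tm X" for X by (auto intro: inj_onI)
    have "finite {a. Tm a \<in> set \<alpha>}" using eq inj finite_imageD finite_subset List.finite_set by metis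
    moreover have "card {a. Tm a \<in> set \<alpha>} \<le> card (set \<alpha>)"
      using card_image[OF inj] card_mono[OF _ eq] by (metis List.finite_set)
    ultimately show ?thesis using card_length[of \<alpha>] by linarith
  qed
  then have "finite ?L" using slpD(2)[OF assms] by auto
  then have "card (set (slp_val G)) \<le> card ?L" using card_mono \<open>set (slp_val G) \<subseteq> ?L\<close> by blast
  also have "\<dots> \<le> (\<Sum>p\<in>productions G. card (case p of (A, \<alpha>) \<Rightarrow> {a. Tm a \<in> set \<alpha>}))"
    using card_UN_le[OF slpD(2)[OF assms]] .
  also have "\<dots> \<le> slp_size G"
    unfolding slp_size_def using fin by (intro sum_mono) auto
  finally show ?thesis .
qed


section \<open>Unary encoding of the letters\<close>

definition unary_code :: "nat \<Rightarrow> nat list" where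
  "unary_code i = replicate i 1 @ [2]"

lemma unary_code_0: "unary_code 0 = [2]"
  and unary_code_Suc: "unary_code (Suc i) = 1 # unary_code i"
  by (simp_all add: unary_code_def)

definition encode_word :: "(nat \<Rightarrow> nat) \<Rightarrow> nat list \<Rightarrow> nat list" where
  "encode_word idx w = concat (map (\<lambda>a. unary_code (idx a)) w)"

text \<open>
  The nonterminals \<open>i < k\<close> produce the code words; the nonterminals of the given program are
  shifted by \<open>k\<close>, and its letters are replaced by the nonterminals of their codes.
\<close>

fun encode_sym :: "nat \<Rightarrow> (nat \<Rightarrow> nat) \<Rightarrow> sym \<Rightarrow> sym" where
  "encode_sym k idx (NT A) = NT (A + k)"
| "encode_sym k idx (Tm a) = NT (idx a)"

definition encode_productions :: "nat \<Rightarrow> (nat \<Rightarrow> nat) \<Rightarrow> grammar \<Rightarrow> (nat \<times> sym list) set" where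
  "encode_productions k idx G = {(0, [Tm 2])} \<union> (\<lambda>i. (Suc i, [Tm 1, NT i])) ` {..<k - 1} \<union>
        (\<lambda>(A, \<alpha>). (A + k, map (encode_sym k idx) \<alpha>)) ` productions G"

definition encode_grammar :: "nat \<Rightarrow> (nat \<Rightarrow> nat) \<Rightarrow> grammar \<Rightarrow> grammar" where
  "encode_grammar k idx G =
     \<lparr> nonterminals = {..<k} \<union> (\<lambda>A. A + k) ` nonterminals G,
       productions = encode_productions k idx G, start = start G + k \<rparr>"

lemma encode_productions_iff:
  assumes "k > 0"
  shows "(A, \<beta>) \<in> encode_productions k idx G \<longleftrightarrow>
    (if A < k then \<beta> = (case A of 0 \<Rightarrow> [Tm 2] | Suc i \<Rightarrow> [Tm 1, NT i])
     else \<exists>\<alpha>. (A - k, \<alpha>) \<in> productions G \<and> \<beta> = map (encode_sym k idx) \<alpha>)"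
proof (cases "A < k")
  case True
  then show ?thesis
    by (cases A) (auto simp: encode_productions_def)
next
  case False
  then have "A \<noteq> 0" "A \<notin> Suc ` {..<k - 1}" using assms by auto
  then have "(A, \<beta>) \<in> encode_productions k idx G \<longleftrightarrow>
      (A, \<beta>) \<in> (\<lambda>(A, \<alpha>). (A + k, map (encode_sym k idx) \<alpha>)) ` productions G"
    unfolding encode_productions_def by blast
  also have "\<dots> \<longleftrightarrow> (\<exists>\<alpha>. (A - k, \<alpha>) \<in> productions G \<and> \<beta> = map (encode_sym k idx) \<alpha>)"
  proof
    assume "\<exists>\<alpha>. (A - k, \<alpha>) \<in> productions G \<and> \<beta> = map (encode_sym k idx) \<alpha>"
    then obtain \<alpha> where "(A - k, \<alpha>) \<in> productions G" "\<beta> = map (encode_sym k idx) \<alpha>" by blast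
    then show "(A, \<beta>) \<in> (\<lambda>(A, \<alpha>). (A + k, map (encode_sym k idx) \<alpha>)) ` productions G"
      using False by (intro image_eqI[of _ _ "(A - k, \<alpha>)"]) auto
  qed auto
  finally show ?thesis using False by simp
qed

context
  fixes G :: grammar and k :: nat and idx :: "nat \<Rightarrow> nat"
  assumes G: "slp G" and k: "k > 0" and idx: "\<And>a. idx a < k"
begin

lemma slp_encode_grammar: "slp (encode_grammar k idx G)"
proof -
  let ?G = "encode_grammar k idx G"
  note h = nt_rank_less[OF G] nt_rank_bound[OF G]
  have rhs: "A \<in> nonterminals ?G \<and> \<beta> \<noteq> [] \<and> set \<beta> \<subseteq> NT ` nonterminals ?G \<union> Tm ` {1,2}"
    if mem: "(A, \<beta>) \<in> encode_productions k idx G" for A \<beta>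
  proof (cases "A < k")
    case True
    then show ?thesis using mem by (cases A) (auto simp: encode_productions_iff[OF k] encode_grammar_def)
  next
    case False
    then obtain \<alpha> where \<alpha>: "(A - k, \<alpha>) \<in> productions G" "\<beta> = map (encode_sym k idx) \<alpha>"
      using mem by (auto simp: encode_productions_iff[OF k])
    have "encode_sym k idx X \<in> NT ` nonterminals ?G" if "X \<in> set \<alpha>" for X
      using slpD(6)[OF G \<alpha>(1)] that idx by (cases X) (auto simp: encode_grammar_def)
    moreover have "A \<in> nonterminals ?G"
      using slpD(4)[OF G \<alpha>(1)] False by (auto simp: encode_grammar_def image_iff intro!: bexI[of _ "A - k"])
    ultimately show ?thesis using \<alpha>(2) slpD(5)[OF G \<alpha>(1)] by auto
  qed
  have ex1: "\<exists>!\<beta>. (A, \<beta>) \<in> encode_productions k idx G" if "A \<in> nonterminals ?G" for A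
  proof (cases "A < k")
    case True
    then show ?thesis by (auto simp: encode_productions_iff[OF k])
  next
    case False
    then have "A - k \<in> nonterminals G" using that by (auto simp: encode_grammar_def)
    then obtain \<alpha> where \<alpha>: "(A - k, \<alpha>) \<in> productions G" using slpD(8)[OF G] by blast
    have "(A, \<beta>) \<in> encode_productions k idx G \<longleftrightarrow> \<beta> = map (encode_sym k idx) \<alpha>" for \<beta>
    proof -
      have "(\<exists>\<alpha>'. (A - k, \<alpha>') \<in> productions G \<and> \<beta> = map (encode_sym k idx) \<alpha>') \<longleftrightarrow>
          \<beta> = map (encode_sym k idx) \<alpha>"
        using \<alpha> slpD(7)[OF G \<alpha>] by blast
      then show ?thesis unfolding encode_productions_iff[OF k] using False by simp
    qed
    then show ?thesis by simp
  qed
  have acyc: "acyclic {(A, B). A \<in> nonterminals ?G \<and> B \<in> nonterminals ?G \<and>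
                      (\<exists>\<alpha>. (A, \<alpha>) \<in> productions ?G \<and> NT B \<in> set \<alpha>)}"
  \<comment> \<open>Code nonterminals are ranked by their index, below all the shifted nonterminals,
    which keep their old order.\<close>
  proof (rule acyclicI_measure[where f = "\<lambda>A. if A < k then A else k + nt_rank G (A - k)"])
    fix A B assume "(A, B) \<in> {(A, B). A \<in> nonterminals ?G \<and> B \<in> nonterminals ?G \<and>
                      (\<exists>\<alpha>. (A, \<alpha>) \<in> productions ?G \<and> NT B \<in> set \<alpha>)}"
    then obtain \<beta> where \<beta>: "(A, \<beta>) \<in> encode_productions k idx G" "NT B \<in> set \<beta>"
      by (auto simp: encode_grammar_def)
    show "(if B < k then B else k + nt_rank G (B - k)) < (if A < k then A else k + nt_rank G (A - k))"
    proof (cases "A < k")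
      case True
      then show ?thesis using \<beta> by (cases A) (auto simp: encode_productions_iff[OF k])
    next
      case False
      then obtain \<alpha> where \<alpha>: "(A - k, \<alpha>) \<in> productions G" "\<beta> = map (encode_sym k idx) \<alpha>"
        using \<beta>(1) by (auto simp: encode_productions_iff[OF k])
      obtain X where X: "X \<in> set \<alpha>" "NT B = encode_sym k idx X" using \<alpha>(2) \<beta>(2) by auto
      show ?thesis
      proof (cases X)
        case (NT C)
        then show ?thesis using X False h(1)[OF \<alpha>(1)] by auto
      next
        case (Tm a)
        then show ?thesis using X False idx[of a] by auto
      qed
    qed
  qed
  have "slp_over {1, 2} ?G"
    unfolding slp_over_def
  proof (intro conjI)
    show "finite (nonterminals ?G)" "finite (productions ?G)" "start ?G \<in> nonterminals ?G"
      using slpD(1-3)[OF G] by (auto simp: encode_grammar_def encode_productions_def)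
    show "\<forall>(A, \<alpha>)\<in>productions ?G. A \<in> nonterminals ?G \<and> \<alpha> \<noteq> [] \<and>
       set \<alpha> \<subseteq> NT ` nonterminals ?G \<union> Tm ` {1,2}"
      using rhs by (auto simp: encode_grammar_def)
    show "\<forall>A\<in>nonterminals ?G. \<exists>!\<alpha>. (A, \<alpha>) \<in> productions ?G"
      using ex1 by (simp add: encode_grammar_def)
  qed (use acyc in auto)
  then show ?thesis unfolding slp_def by blast
qed

lemma slp_val_encode_grammar: "slp_val (encode_grammar k idx G) = encode_word idx (slp_val G)"
proof -
  obtain v where v: "is_valuation G v" using exists_valuation[OF G] by blast
  define v' where "v' = (\<lambda>A. if A < k then unary_code A else encode_word idx (v (A - k)))"
  have "is_valuation (encode_grammar k idx G) v'"
    unfolding is_valuation_def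
  proof clarify
    fix A \<beta> assume "(A, \<beta>) \<in> productions (encode_grammar k idx G)"
    then have \<beta>: "(A, \<beta>) \<in> encode_productions k idx G" by (simp add: encode_grammar_def)
    show "v' A = rhs_val v' \<beta>"
    proof (cases "A < k")
      case True
      then show ?thesis using \<beta>
        by (cases A) (auto simp: encode_productions_iff[OF k] v'_def unary_code_0 unary_code_Suc)
    next
      case False
      then obtain \<alpha> where \<alpha>: "(A - k, \<alpha>) \<in> productions G" "\<beta> = map (encode_sym k idx) \<alpha>"
        using \<beta> by (auto simp: encode_productions_iff[OF k])
      have X: "sym_val v' (encode_sym k idx X) = encode_word idx (sym_val v X)" for X
        using idx by (cases X) (auto simp: v'_def encode_word_def)
      have "rhs_val v' (map (encode_sym k idx) \<alpha>) = encode_word idx (rhs_val v \<alpha>)"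
        by (induction \<alpha>) (auto simp: X, auto simp: encode_word_def)
      then show ?thesis using \<alpha>(2) is_valuationD[OF v \<alpha>(1)] False by (simp add: v'_def)
    qed
  qed
  from slp_val_eq[OF slp_encode_grammar this] show ?thesis
    using slp_val_eq[OF G v] by (simp add: encode_grammar_def v'_def)
qed

lemma slp_size_encode_grammar: "slp_size (encode_grammar k idx G) \<le> slp_size G + 2 * k"
proof -
  let ?l = "\<lambda>(A :: nat, \<alpha> :: sym list). length \<alpha>"
  let ?P1 = "{(0, [Tm 2])} \<union> (\<lambda>i. (Suc i, [Tm 1, NT i])) ` {..<k - 1}"
  let ?P2 = "(\<lambda>(A, \<alpha>). (A + k, map (encode_sym k idx) \<alpha>)) ` productions G"
  have "sum ?l (?P1 \<union> ?P2) \<le> sum ?l ?P1 + sum ?l ?P2"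
    using slpD(2)[OF G] by (subst sum_Un_nat) (auto simp del: Un_insert_left)
  \<comment> \<open>One symbol for the code \<open>2\<close>, and two for each of the other
    \<open>k - 1\<close> codes.\<close>
  moreover have "sum ?l ?P1 \<le> 1 + 2 * (k - 1)"
  proof -
    have "sum ?l ((\<lambda>i. (Suc i, [Tm 1, NT i])) ` {..<k - 1}) = 2 * (k - 1)"
      by (subst sum.reindex) (auto intro: inj_onI)
    then show ?thesis by (subst sum.union_disjoint) auto
  qed
  moreover have "sum ?l ?P2 \<le> slp_size G"
  proof -
    have "sum ?l ?P2 \<le> sum (?l \<circ> (\<lambda>(A, \<alpha>). (A + k, map (encode_sym k idx) \<alpha>))) (productions G)"
      by (rule sum_image_le) (use slpD(2)[OF G] in auto)
    also have "\<dots> = slp_size G" unfolding slp_size_def by (rule sum.cong) auto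
    finally show ?thesis .
  qed
  ultimately have "sum ?l (?P1 \<union> ?P2) \<le> slp_size G + 2 * k" using k by linarith
  then show ?thesis by (simp add: slp_size_def encode_grammar_def encode_productions_def)
qed

end


section \<open>Decoding a straight-line program\<close>

text \<open>
  Here \<open>c\<close> counts the \<open>1\<close>s pending from the text before \<open>x\<close>. Useless nonterminals may contain
  arbitrary letters, so every letter other than \<open>1\<close> is taken to end a code word.
\<close>

fun decode :: "nat \<Rightarrow> nat list \<Rightarrow> nat list" where
  "decode c [] = []"
| "decode c (a # x) = (if a = 1 then decode (Suc c) x else c # decode 0 x)"

text \<open>With \<open>decode\<close>, the final state and the output of one transducer that counts
  1s.\<close>

fun pending :: "nat \<Rightarrow> nat list \<Rightarrow> nat" where
  "pending c [] = c"
| "pending c (a # x) = (if a = 1 then pending (Suc c) x else pending 0 x)"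

text \<open>The length of the maximal prefix of 1s: the first number decoded, or the length of
  \<open>x\<close> if no code ends in it.\<close>

definition leading :: "nat list \<Rightarrow> nat" where
  "leading x = (if decode 0 x = [] then pending 0 x else hd (decode 0 x))"

lemma decode_append: "decode c (x @ y) = decode c x @ decode (pending c x) y"
  by (induction c x rule: decode.induct) auto

lemma pending_append: "pending c (x @ y) = pending (pending c x) y"
  by (induction c x rule: decode.induct) auto

text \<open>The count is reset at the end of the first code, so text to the left affects only the
  first number. This is what makes decoding compositional.\<close>

lemma decode_shift:
  "decode (b + c) x = (case decode c x of [] \<Rightarrow> [] | m # r \<Rightarrow> (b + m) # r)"
proof (induction c x rule: decode.induct)
  case (2 c a x)
  then show ?case using 2(1) by auto
qed simp

lemma pending_shift: "pending (b + c) x = (if decode c x = [] then b + pending c x else pending c x)"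
proof (induction c x rule: decode.induct)
  case (2 c a x)
  then show ?case using 2(1) by auto
qed simp

lemma decode_pending:
  "decode c x = (if decode 0 x = [] then [] else (c + leading x) # tl (decode 0 x))"
  using decode_shift[of c 0 x] by (cases "decode 0 x") (auto simp: leading_def)

lemma leading_append:
  "leading (x @ y) = (if decode 0 x = [] then pending 0 x + leading y else leading x)"
proof (cases "decode 0 y = []")
  case True
  then show ?thesis
    using decode_pending[of "pending 0 x" y] pending_shift[of "pending 0 x" 0 y]
    by (auto simp: leading_def decode_append pending_append)
next
  case False
  then show ?thesis
    using decode_pending[of "pending 0 x" y]
    by (auto simp: leading_def decode_append pending_append)
qed

lemma decode_encode_word: "decode 0 (encode_word idx w) = map idx w"
proof -
  have *: "decode c (unary_code i @ x) = (c + i) # decode 0 x" for c i x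
    by (induction i arbitrary: c) (auto simp: unary_code_0 unary_code_Suc)
  show ?thesis by (induction w) (auto simp: encode_word_def *)
qed

text \<open>The default 0 serves counts beyond the alphabet; when the value is an encoded word, only
  useless nonterminals lead to them.\<close>

definition hd0 :: "nat list \<Rightarrow> nat" where
  "hd0 xs = (case xs of [] \<Rightarrow> 0 | x # _ \<Rightarrow> x)"

text \<open>
  A nonterminal \<open>A\<close> is summarized by a triple: a list whose length is the number of leading \<open>1\<close>s of
  \<open>val A\<close>, capped at the length of the alphabet \<open>d\<close>; the suffix of \<open>d\<close> left after dropping
  the number of pending \<open>1\<close>s (relevant only if \<open>val A\<close> contains a \<open>2\<close>); and a right-hand side
  for the decoding of \<open>val A\<close>, whose first symbol is the letter whose code may begin to the left
  of \<open>val A\<close>. The cap keeps everything small even for useless nonterminals with long values.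
  In the summary of a terminal, \<open>Tm 0\<close> is a placeholder: of a symbol's right-hand side, only the
  emptiness and that of its tail matter.
\<close>

type_synonym info = "nat list \<times> nat list \<times> sym list"

fun sym_info :: "nat list \<Rightarrow> (nat \<Rightarrow> info) \<Rightarrow> sym \<Rightarrow> info" where
  "sym_info d L (NT A) = L A"
| "sym_info d L (Tm a) = (if a = 1 then ([0], [], []) else ([], d, [Tm 0]))"

text \<open>The state \<open>(f, c, out)\<close> holds the suffixes of \<open>d\<close> for the leading and the pending \<open>1\<close>s
  read so far, and the output in reverse.\<close>

fun scan_step :: "nat list \<Rightarrow> (nat \<Rightarrow> info) \<Rightarrow> sym \<Rightarrow> info \<Rightarrow> info" where
  "scan_step d L X (f, c, out) = (case sym_info d L X of (m, n, u) \<Rightarrow>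
     let c' = drop (length m) c; f' = (if out = [] then c' else f)
     in if u = [] then (f', c', out)
        else (f', n, if tl u = [] then Tm (hd0 c') # out else X # Tm (hd0 c') # out))"

text \<open>As \<open>f\<close> is \<open>d\<close> without as many entries as there are leading 1s,
  \<open>drop (length f) d\<close> is a list whose length is that count, capped: a subtraction by
  dropping.\<close>

definition rhs_info :: "nat list \<Rightarrow> (nat \<Rightarrow> info) \<Rightarrow> sym list \<Rightarrow> info" where
  "rhs_info d L \<alpha> = (case fold (scan_step d L) \<alpha> (d, d, []) of
     (f, c, out) \<Rightarrow> (drop (length f) d, c, rev out))"

lemma rhs_info_cong:
  assumes "\<And>A. NT A \<in> set \<alpha> \<Longrightarrow> L A = L' A"
  shows "rhs_info d L \<alpha> = rhs_info d L' \<alpha>"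
proof -
  have "scan_step d L X s = scan_step d L' X s" if "X \<in> set \<alpha>" for X s
    using assms that by (cases X; cases s) auto
  then have "fold (scan_step d L) \<alpha> s = fold (scan_step d L') \<alpha> s" for s
    by (intro fold_cong) auto
  then show ?thesis by (simp add: rhs_info_def)
qed

lemma length_out_rhs_info: "length (snd (snd (rhs_info d L \<alpha>))) \<le> 2 * length \<alpha>"
proof -
  have "length (snd (snd (fold (scan_step d L) \<alpha> s))) \<le> length (snd (snd s)) + 2 * length \<alpha>" for s
  proof (induction \<alpha> arbitrary: s)
    case (Cons X \<alpha>)
    have "length (snd (snd (scan_step d L X s))) \<le> length (snd (snd s)) + 2"
      by (cases s) (auto simp: Let_def split: prod.split)
    then show ?case using Cons[of "scan_step d L X s"] by simp
  qed simp
  from this[of "(d, d, [])"] show ?thesis by (auto simp: rhs_info_def split: prod.splits)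
qed

section \<open>Correctness of the summaries\<close>

context
  fixes d :: "nat list" and v :: "nat \<Rightarrow> nat list"
begin

definition letter :: "nat \<Rightarrow> nat" where
  "letter c = hd0 (drop c d)"

text \<open>The first code may begin to the left of \<open>A\<close>, so its letter is supplied by
  the right-hand side in which \<open>A\<close> stands.\<close>

definition inner_val :: "nat \<Rightarrow> nat list" where
  "inner_val A = map letter (tl (decode 0 (v A)))"

text \<open>The count \<open>m\<close> is described by its effect on suffixes of \<open>d\<close>,
  not by its length: there the cap is invisible, since past the end of \<open>d\<close> nothing is
  left to drop.\<close>

definition info_ok :: "nat list \<Rightarrow> info \<Rightarrow> bool" where
  "info_ok x i \<longleftrightarrow> (case i of (m, n, u) \<Rightarrow>
     (\<forall>c. drop (length m) (drop c d) = drop (c + leading x) d) \<and>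
     (u \<noteq> [] \<longrightarrow> n = drop (pending 0 x) d) \<and>
     (u = [] \<longleftrightarrow> decode 0 x = []) \<and> (tl u = [] \<longleftrightarrow> tl (decode 0 x) = []))"

text \<open>What is kept stems from the old right-hand side, which preserves acyclicity, and still
  has something to produce, so nonterminals with empty inner word can be removed.\<close>

definition inner_syms :: "sym list \<Rightarrow> sym list \<Rightarrow> bool" where
  "inner_syms \<alpha> \<beta> \<longleftrightarrow> (\<forall>A. NT A \<in> set \<beta> \<longrightarrow> NT A \<in> set \<alpha> \<and> tl (decode 0 (v A)) \<noteq> [])"

text \<open>The invariant of the scan. As the output begins with a terminal, taking the tail removes
  exactly the first letter.\<close>

definition scan_ok :: "sym list \<Rightarrow> info \<Rightarrow> bool" where
  "scan_ok \<alpha> s \<longleftrightarrow> (case s of (f, c, out) \<Rightarrow> let x = rhs_val v \<alpha> in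
     c = drop (pending 0 x) d \<and> f = drop (leading x) d \<and>
     rhs_val inner_val (rev out) = map letter (decode 0 x) \<and>
     (out = [] \<longleftrightarrow> decode 0 x = []) \<and>
     (out \<noteq> [] \<longrightarrow> hd (rev out) = Tm (letter (leading x))) \<and> inner_syms \<alpha> out)"

lemma scan_step_ok:
  assumes s: "scan_ok \<alpha> s" and X: "info_ok (sym_val v X) (sym_info d L X)"
  shows "scan_ok (\<alpha> @ [X]) (scan_step d L X s)"
proof -
  obtain f c out where seq: "s = (f, c, out)" by (cases s)
  obtain m n u where i: "sym_info d L X = (m, n, u)" by (cases "sym_info d L X")
  define x where "x = rhs_val v \<alpha>"
  define y where "y = sym_val v X"
  have xy: "rhs_val v (\<alpha> @ [X]) = x @ y" by (simp add: x_def y_def)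
  have s': "c = drop (pending 0 x) d" "f = drop (leading x) d"
     "rhs_val inner_val (rev out) = map letter (decode 0 x)"
     "out = [] \<longleftrightarrow> decode 0 x = []"
     "out \<noteq> [] \<longrightarrow> hd (rev out) = Tm (letter (leading x))" "inner_syms \<alpha> out"
    using s unfolding scan_ok_def seq x_def by (simp_all add: Let_def)
  have X': "\<And>c. drop (length m) (drop c d) = drop (c + leading y) d"
     "u \<noteq> [] \<longrightarrow> n = drop (pending 0 y) d"
     "u = [] \<longleftrightarrow> decode 0 y = []" "tl u = [] \<longleftrightarrow> tl (decode 0 y) = []"
    using X unfolding info_ok_def i y_def by simp_all
  \<comment> \<open>On suffixes of \<open>d\<close>, dropping adds counts: \<open>c'\<close> stands
    for the pending 1s plus those leading \<open>X\<close>, and its head is the letter of the first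
    code that ends in \<open>X\<close>, if one does. While no code has ended, all 1s read are
    leading, hence \<open>f'\<close> follows \<open>c'\<close>.\<close>
  define c' where "c' = drop (length m) c"
  define f' where "f' = (if out = [] then c' else f)"
  have c': "c' = drop (pending 0 x + leading y) d" using s'(1) X'(1) by (simp add: c'_def)
  have f': "f' = drop (leading (x @ y)) d"
    using c' s'(2,4) by (simp add: f'_def leading_append)
  have dec: "decode 0 (x @ y) = decode 0 x @ (if decode 0 y = [] then [] else (pending 0 x + leading y) # tl (decode 0 y))"
    unfolding decode_append using decode_pending[of "pending 0 x" y] by simp
  have pend: "pending 0 (x @ y) = (if decode 0 y = [] then pending 0 x + leading y else pending 0 y)"
    unfolding pending_append using pending_shift[of "pending 0 x" 0 y] by (simp add: leading_def)
  have inner: "inner_syms (\<alpha> @ [X]) out" using s'(6) unfolding inner_syms_def by auto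
  show ?thesis
  proof (cases "u = []")
    case True
    then have "scan_step d L X s = (f', c', out)"
      by (simp add: seq i c'_def f'_def Let_def)
    then show ?thesis
      unfolding scan_ok_def xy Let_def using True X'(3) f' c' dec pend inner s'
      by (simp add: leading_append)
  next
    case False
    define out' where "out' = (if tl u = [] then Tm (hd0 c') # out else X # Tm (hd0 c') # out)"
    have st: "scan_step d L X s = (f', n, out')"
      using False by (simp add: seq i c'_def f'_def out'_def Let_def)
    have dy: "decode 0 y \<noteq> []" using False X'(3) by simp
    have hd0: "hd0 c' = letter (pending 0 x + leading y)" by (simp add: c' letter_def)
    \<comment> \<open>The summary of a terminal has at most one symbol, so a symbol that is kept is
      a nonterminal.\<close>
    have NT: "\<exists>A. X = NT A \<and> y = v A" if "tl u \<noteq> []"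
      using that i by (cases X) (auto simp: y_def split: if_splits)
    have "rhs_val inner_val (rev out') = map letter (decode 0 (x @ y))"
      using s'(3) dy NT X'(4) by (auto simp: out'_def dec hd0 inner_val_def)
    moreover have "hd (rev out') = Tm (letter (leading (x @ y)))"
    proof (cases "out = []")
      case True
      then show ?thesis using s'(4) by (simp add: out'_def hd0 leading_append)
    next
      case False
      then show ?thesis using s'(4,5) by (simp add: out'_def leading_append)
    qed
    moreover have "inner_syms (\<alpha> @ [X]) out'"
      using inner NT X'(4) by (auto simp: inner_syms_def out'_def)
    moreover have "out' \<noteq> []" by (simp add: out'_def)
    moreover have "n = drop (pending 0 (x @ y)) d" using X'(2) False pend dy by simp
    moreover have "decode 0 (x @ y) \<noteq> []" using dec dy by simp
    ultimately show ?thesis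
      unfolding st scan_ok_def xy Let_def using f' by simp
  qed
qed

lemma rhs_info_ok:
  assumes "\<And>X. X \<in> set \<alpha> \<Longrightarrow> info_ok (sym_val v X) (sym_info d L X)"
  shows "info_ok (rhs_val v \<alpha>) (rhs_info d L \<alpha>)"
    and "rhs_val inner_val (snd (snd (rhs_info d L \<alpha>))) = map letter (decode 0 (rhs_val v \<alpha>))"
    and "rhs_val inner_val (tl (snd (snd (rhs_info d L \<alpha>)))) = map letter (tl (decode 0 (rhs_val v \<alpha>)))"
    and "inner_syms \<alpha> (snd (snd (rhs_info d L \<alpha>)))"
proof -
  have "scan_ok \<alpha> (fold (scan_step d L) \<alpha> (d, d, []))"
    using assms
  proof (induction \<alpha> rule: rev_induct)
    case Nil
    show ?case by (simp add: scan_ok_def leading_def inner_syms_def)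
  next
    case (snoc X \<alpha>)
    then show ?case using scan_step_ok by simp
  qed
  then obtain f c out where s: "fold (scan_step d L) \<alpha> (d, d, []) = (f, c, out)"
    and ok: "scan_ok \<alpha> (f, c, out)"
    by (cases "fold (scan_step d L) \<alpha> (d, d, [])") auto
  define x where "x = rhs_val v \<alpha>"
  have i: "rhs_info d L \<alpha> = (drop (length f) d, c, rev out)" by (simp add: rhs_info_def s)
  have ok': "c = drop (pending 0 x) d" "f = drop (leading x) d"
     "rhs_val inner_val (rev out) = map letter (decode 0 x)"
     "out = [] \<longleftrightarrow> decode 0 x = []"
     "out \<noteq> [] \<longrightarrow> hd (rev out) = Tm (letter (leading x))" "inner_syms \<alpha> out"
    using ok unfolding scan_ok_def x_def by (simp_all add: Let_def)
  have tl: "rhs_val inner_val (tl (rev out)) = map letter (tl (decode 0 x))"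
  proof (cases "rev out")
    case (Cons X r)
    then have "X = Tm (letter (leading x))" using ok'(5) by auto
    then show ?thesis using ok'(3) Cons by (metis list.sel(3) map_tl append_Cons append_Nil rhs_val_simps(2) sym_val.simps(2))
  qed (use ok' in simp)
  \<comment> \<open>Letters and kept nonterminals have nonempty values, so emptiness of the tail can
    be read off its value.\<close>
  have ne: "rhs_val inner_val \<beta> \<noteq> []" if "\<beta> \<noteq> []" "inner_syms \<alpha> \<beta>" for \<beta>
  proof (cases \<beta>)
    case (Cons X r)
    then show ?thesis using that by (cases X) (auto simp: inner_syms_def inner_val_def)
  qed (use that in simp)
  have inner: "inner_syms \<alpha> (rev out)" "inner_syms \<alpha> (tl (rev out))"
    using ok'(6) unfolding inner_syms_def by (cases "rev out"; auto dest: arg_cong[of _ _ set])+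
  have "tl (rev out) = [] \<longleftrightarrow> tl (decode 0 x) = []"
    using tl ne[OF _ inner(2)] by (metis map_is_Nil_conv rhs_val_simps(1))
  \<comment> \<open>If there are more leading 1s than entries of \<open>d\<close>, then
    \<open>f\<close> is empty and both sides are \<open>[]\<close>.\<close>
  moreover have "drop (length (drop (length f) d)) (drop c d) = drop (c + leading x) d" for c
    using ok'(2) by (cases "leading x \<le> length d") (auto simp: add.commute)
  ultimately show "info_ok (rhs_val v \<alpha>) (rhs_info d L \<alpha>)"
    unfolding i info_ok_def x_def[symmetric] using ok' by auto
  show "rhs_val inner_val (snd (snd (rhs_info d L \<alpha>))) = map letter (decode 0 (rhs_val v \<alpha>))"
    "rhs_val inner_val (tl (snd (snd (rhs_info d L \<alpha>)))) = map letter (tl (decode 0 (rhs_val v \<alpha>)))"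
    "inner_syms \<alpha> (snd (snd (rhs_info d L \<alpha>)))"
    using ok'(3) tl inner(1) by (simp_all add: i x_def)
qed

end

text \<open>Nothing precedes the value of the start nonterminal, so it keeps its first letter; all
  others leave theirs to the context.\<close>

definition decoded_rhs :: "nat \<Rightarrow> (nat \<Rightarrow> info) \<Rightarrow> nat \<Rightarrow> sym list" where
  "decoded_rhs S L A = (if A = S then snd (snd (L A)) else tl (snd (snd (L A))))"

text \<open>Nonterminals left with nothing to produce are removed, as right-hand sides must be
  nonempty; by \<open>decoded_NT\<close> none of them still occurs.\<close>

definition decode_grammar :: "(nat \<Rightarrow> info) \<Rightarrow> grammar \<Rightarrow> grammar" where
  "decode_grammar L G = (let P = {(A, decoded_rhs (start G) L A) | A.
       A \<in> nonterminals G \<and> decoded_rhs (start G) L A \<noteq> []}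
     in \<lparr> nonterminals = fst ` P, productions = P, start = start G \<rparr>)"

context
  fixes G :: grammar and d :: "nat list" and L :: "nat \<Rightarrow> info" and v :: "nat \<Rightarrow> nat list"
  assumes G: "slp G" and v: "is_valuation G v" and d: "d \<noteq> []"
    and L: "\<And>A \<alpha>. (A, \<alpha>) \<in> productions G \<Longrightarrow> L A = rhs_info d L \<alpha>"
    and start: "decode 0 (slp_val G) \<noteq> []"
begin

text \<open>\<open>L\<close> may be any solution of the summary equations: induction on the rank
  carries correctness upwards from the terminals.\<close>

lemma nt_info_ok: "A \<in> nonterminals G \<Longrightarrow> info_ok d (v A) (L A)"
  and sym_info_ok: "(A, \<alpha>) \<in> productions G \<Longrightarrow> X \<in> set \<alpha> \<Longrightarrow> info_ok d (sym_val v X) (sym_info d L X)"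
proof -
  have Tm: "info_ok d [a] (sym_info d L (Tm a))" for a
    using d by (auto simp: info_ok_def leading_def drop_Suc drop_tl simp flip: tl_drop)
  show *: "info_ok d (v A) (L A)" if "A \<in> nonterminals G" for A
    using that
  proof (induction "nt_rank G A" arbitrary: A rule: less_induct)
    case less
    obtain \<alpha> where \<alpha>: "(A, \<alpha>) \<in> productions G" using slpD(8)[OF G less.prems] by blast
    have "info_ok d (sym_val v X) (sym_info d L X)" if "X \<in> set \<alpha>" for X
    proof (cases X)
      case (NT B)
      then have B: "NT B \<in> set \<alpha>" using that by simp
      show ?thesis using less.hyps[OF nt_rank_less[OF G \<alpha> B] slpD(6)[OF G \<alpha> B]] NT by simp
    qed (use Tm in simp)
    from rhs_info_ok(1)[OF this] show ?case using L[OF \<alpha>] is_valuationD[OF v \<alpha>] by simp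
  qed
  show "info_ok d (sym_val v X) (sym_info d L X)" if "(A, \<alpha>) \<in> productions G" "X \<in> set \<alpha>"
  proof (cases X)
    case (NT B)
    then show ?thesis using * slpD(6)[OF G that(1)] that(2) by simp
  qed (use Tm in simp)
qed

lemma out_props:
  assumes "(A, \<alpha>) \<in> productions G"
  shows "rhs_val (inner_val d v) (snd (snd (L A))) = map (letter d) (decode 0 (v A))"
    and "rhs_val (inner_val d v) (tl (snd (snd (L A)))) = inner_val d v A"
    and "inner_syms v \<alpha> (snd (snd (L A)))"
    and "snd (snd (L A)) = [] \<longleftrightarrow> decode 0 (v A) = []"
    and "tl (snd (snd (L A))) = [] \<longleftrightarrow> tl (decode 0 (v A)) = []"
proof -
  have X: "\<And>X. X \<in> set \<alpha> \<Longrightarrow> info_ok d (sym_val v X) (sym_info d L X)"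
    using sym_info_ok[OF assms] by blast
  show "rhs_val (inner_val d v) (snd (snd (L A))) = map (letter d) (decode 0 (v A))"
    "rhs_val (inner_val d v) (tl (snd (snd (L A)))) = inner_val d v A"
    "inner_syms v \<alpha> (snd (snd (L A)))"
    using rhs_info_ok(2-4)[OF X] L[OF assms] is_valuationD[OF v assms]
    by (auto simp: inner_val_def)
  show "snd (snd (L A)) = [] \<longleftrightarrow> decode 0 (v A) = []"
    "tl (snd (snd (L A))) = [] \<longleftrightarrow> tl (decode 0 (v A)) = []"
    using nt_info_ok[OF slpD(4)[OF G assms]] by (auto simp: info_ok_def split: prod.splits)
qed

lemma start_out: "decoded_rhs (start G) L (start G) \<noteq> []"
proof -
  obtain \<alpha> where \<alpha>: "(start G, \<alpha>) \<in> productions G" using slpD(3,8)[OF G] by blast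
  show ?thesis
    using out_props(4)[OF \<alpha>] start slp_val_eq[OF G v] by (simp add: decoded_rhs_def)
qed

lemma decoded_NT:
  assumes "NT B \<in> set (decoded_rhs (start G) L A)" "(A, \<alpha>) \<in> productions G"
  shows "NT B \<in> set \<alpha>" "tl (snd (snd (L B))) \<noteq> []" "B \<in> nonterminals G"
proof -
  have "NT B \<in> set (snd (snd (L A)))"
    using assms(1) list.set_sel(2)[of "snd (snd (L A))"] unfolding decoded_rhs_def
    by (cases "snd (snd (L A))") (auto split: if_splits)
  then have B: "NT B \<in> set \<alpha>" "tl (decode 0 (v B)) \<noteq> []"
    using out_props(3)[OF assms(2)] unfolding inner_syms_def by blast+
  then show "NT B \<in> set \<alpha>" "B \<in> nonterminals G" using slpD(6)[OF G assms(2)] by blast+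
  then obtain \<beta> where "(B, \<beta>) \<in> productions G" using slpD(8)[OF G] by blast
  from out_props(5)[OF this] show "tl (snd (snd (L B))) \<noteq> []" using B(2) by simp
qed

lemma decoded_rhs_nonempty:
  assumes "tl (snd (snd (L B))) \<noteq> []"
  shows "decoded_rhs (start G) L B \<noteq> []"
  using assms by (auto simp: decoded_rhs_def)

lemma slp_decode_grammar: "slp (decode_grammar L G)"
proof -
  let ?D = "decode_grammar L G"
  let ?r = "decoded_rhs (start G) L"
  let ?\<Sigma> = "\<Union>A \<in> nonterminals G. {a. Tm a \<in> set (?r A)}"
  have P: "(A, \<beta>) \<in> productions ?D \<longleftrightarrow> A \<in> nonterminals G \<and> \<beta> = ?r A \<and> \<beta> \<noteq> []" for A \<beta>
    by (auto simp: decode_grammar_def Let_def)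
  have N: "A \<in> nonterminals ?D \<longleftrightarrow> A \<in> nonterminals G \<and> ?r A \<noteq> []" for A
    by (force simp: decode_grammar_def Let_def)
  have fin: "finite {a. Tm a \<in> set \<beta>}" for \<beta>
    by (rule finite_surj[of "set \<beta>" _ "\<lambda>X. case X of Tm a \<Rightarrow> a | _ \<Rightarrow> 0"]) force+
  have "productions ?D \<subseteq> (\<lambda>A. (A, ?r A)) ` nonterminals G" using P by auto
  then have finP: "finite (productions ?D)" using slpD(1)[OF G] finite_surj by blast
  \<comment> \<open>Decoding deletes nonterminals and inserts letters, so no edge is new and
    acyclicity is inherited.\<close>
  have edge: "B \<in> nonterminals ?D \<and> (A, B) \<in> nt_edges G"
    if "(A, \<beta>) \<in> productions ?D" "NT B \<in> set \<beta>" for A B \<beta>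
  proof -
    have A: "A \<in> nonterminals G" "\<beta> = ?r A" using that P by auto
    obtain \<alpha> where \<alpha>: "(A, \<alpha>) \<in> productions G" using slpD(8)[OF G A(1)] by blast
    note B = decoded_NT[OF that(2)[unfolded A(2)] \<alpha>]
    show ?thesis
      using N[of B] B A(1) \<alpha> decoded_rhs_nonempty unfolding nt_edges_def by blast
  qed
  have "slp_over ?\<Sigma> ?D"
    unfolding slp_over_def
  proof (intro conjI)
    show "finite ?\<Sigma>" using fin slpD(1)[OF G] by blast
    show "finite (productions ?D)" by (fact finP)
    then show "finite (nonterminals ?D)" by (simp add: decode_grammar_def Let_def)
    have "start ?D = start G" by (simp add: decode_grammar_def Let_def)
    then show "start ?D \<in> nonterminals ?D"
      using N start_out slpD(3)[OF G] by simp
    show "\<forall>(A, \<alpha>)\<in>productions ?D. A \<in> nonterminals ?D \<and> \<alpha> \<noteq> [] \<and>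
        set \<alpha> \<subseteq> NT ` nonterminals ?D \<union> Tm ` ?\<Sigma>"
    proof clarify
      fix A \<beta> assume A\<beta>: "(A, \<beta>) \<in> productions ?D"
      have "X \<in> NT ` nonterminals ?D \<union> Tm ` ?\<Sigma>" if "X \<in> set \<beta>" for X
      proof (cases X)
        case (NT B)
        then show ?thesis using edge[OF A\<beta>] that by blast
      next
        case (Tm a)
        have "A \<in> nonterminals G" "\<beta> = ?r A" using A\<beta> P by simp_all
        then have "a \<in> ?\<Sigma>" using Tm that by (intro UN_I[of A]) simp_all
        then show ?thesis using Tm by simp
      qed
      then show "A \<in> nonterminals ?D \<and> \<beta> \<noteq> [] \<and> set \<beta> \<subseteq> NT ` nonterminals ?D \<union> Tm ` ?\<Sigma>"
        using A\<beta> unfolding P N by blast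
    qed
    show "\<forall>A\<in>nonterminals ?D. \<exists>!\<alpha>. (A, \<alpha>) \<in> productions ?D"
    proof
      fix A assume "A \<in> nonterminals ?D"
      then show "\<exists>!\<alpha>. (A, \<alpha>) \<in> productions ?D"
        unfolding P N by (intro ex1I[of _ "?r A"]) simp_all
    qed
    show "acyclic {(A, B). A \<in> nonterminals ?D \<and> B \<in> nonterminals ?D \<and>
        (\<exists>\<alpha>. (A, \<alpha>) \<in> productions ?D \<and> NT B \<in> set \<alpha>)}"
      by (rule acyclic_subset[OF slpD(9)[OF G]]) (use edge in blast)
  qed
  then show ?thesis unfolding slp_def by blast
qed

text \<open>
  The start nonterminal may occur in right-hand sides of useless nonterminals, where its new
  right-hand side does not fit. So the values are compared below the start nonterminal only.
\<close>

lemma slp_val_decode_grammar: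
  "slp_val (decode_grammar L G) = map (letter d) (decode 0 (slp_val G))"
proof -
  let ?D = "decode_grammar L G"
  let ?r = "decoded_rhs (start G) L"
  obtain u where u: "is_valuation ?D u" using exists_valuation[OF slp_decode_grammar] by blast
  have eq: "u A = rhs_val u (?r A)" if "A \<in> nonterminals G" "?r A \<noteq> []" for A
    by (rule is_valuationD[OF u]) (use that in \<open>auto simp: decode_grammar_def Let_def\<close>)
  have inner: "u A = inner_val d v A"
    if "(start G, A) \<in> (nt_edges G)\<^sup>+" "A \<in> nonterminals G" "tl (snd (snd (L A))) \<noteq> []" for A
    using that
  proof (induction "nt_rank G A" arbitrary: A rule: less_induct)
    case less
    obtain \<alpha> where \<alpha>: "(A, \<alpha>) \<in> productions G" using slpD(8)[OF G less.prems(2)] by blast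
    have "A \<noteq> start G" using less.prems(1) slpD(9)[OF G] unfolding acyclic_def by blast
    then have r: "?r A = tl (snd (snd (L A)))" by (simp add: decoded_rhs_def)
    have "u A = rhs_val u (?r A)" using eq less.prems(2,3) r by simp
    also have "\<dots> = rhs_val (inner_val d v) (?r A)"
    proof (rule rhs_val_cong)
      fix B assume "NT B \<in> set (?r A)"
      note B = decoded_NT[OF this \<alpha>]
      have "(A, B) \<in> nt_edges G" using B \<alpha> less.prems(2) unfolding nt_edges_def by blast
      then have "(start G, B) \<in> (nt_edges G)\<^sup>+" using less.prems(1) by simp
      then show "u B = inner_val d v B" using less.hyps nt_rank_less[OF G \<alpha>] B by blast
    qed
    finally show ?case using out_props(2)[OF \<alpha>] r by simp
  qed
  obtain \<alpha> where \<alpha>: "(start G, \<alpha>) \<in> productions G" using slpD(3,8)[OF G] by blast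
  have "slp_val ?D = u (start G)"
    using slp_val_eq[OF slp_decode_grammar u] by (simp add: decode_grammar_def Let_def)
  also have "\<dots> = rhs_val u (?r (start G))" using eq slpD(3)[OF G] start_out by simp
  also have "\<dots> = rhs_val (inner_val d v) (?r (start G))"
  proof (rule rhs_val_cong)
    fix B assume "NT B \<in> set (?r (start G))"
    note B = decoded_NT[OF this \<alpha>]
    have "(start G, B) \<in> nt_edges G" using B \<alpha> slpD(3)[OF G] unfolding nt_edges_def by blast
    then show "u B = inner_val d v B" using inner B by blast
  qed
  also have "\<dots> = map (letter d) (decode 0 (slp_val G))"
    using out_props(1)[OF \<alpha>] slp_val_eq[OF G v] by (simp add: decoded_rhs_def)
  finally show ?thesis .
qed

lemma slp_size_decode_grammar: "slp_size (decode_grammar L G) \<le> 2 * slp_size G"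
proof -
  let ?D = "decode_grammar L G"
  let ?r = "decoded_rhs (start G) L"
  let ?l = "\<lambda>(A :: nat, \<alpha> :: sym list). length \<alpha>"
  have sub: "productions ?D \<subseteq> (\<lambda>(A, \<alpha>). (A, ?r A)) ` productions G"
    using slpD(8)[OF G] by (force simp: decode_grammar_def Let_def)
  have "slp_size ?D \<le> sum ?l ((\<lambda>(A, \<alpha>). (A, ?r A)) ` productions G)"
    unfolding slp_size_def using slpD(2)[OF G] sub by (intro sum_mono2) auto
  also have "\<dots> \<le> sum (?l \<circ> (\<lambda>(A, \<alpha>). (A, ?r A))) (productions G)"
    by (rule sum_image_le) (use slpD(2)[OF G] in auto)
  also have "\<dots> \<le> sum (\<lambda>p. 2 * ?l p) (productions G)"
  proof (rule sum_mono, clarify)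
    fix A \<alpha> assume \<alpha>: "(A, \<alpha>) \<in> productions G"
    have "length (?r A) \<le> length (snd (snd (L A)))" by (simp add: decoded_rhs_def)
    then show "(?l \<circ> (\<lambda>(A, \<alpha>). (A, ?r A))) (A, \<alpha>) \<le> 2 * length \<alpha>"
      using length_out_rhs_info[of d L \<alpha>] L[OF \<alpha>] by simp
  qed
  also have "\<dots> = 2 * slp_size G" by (simp add: slp_size_def sum_distrib_left)
  finally show ?thesis .
qed

end


section \<open>Polynomial-time list functions\<close>

lemma size_enc_tl: "size (enc (tl xs)) \<le> size (enc xs)"
  by (cases xs) auto

lemma size_enc_drop: "size (enc (drop n xs)) \<le> size (enc xs)"
  using size_enc_append[of "take n xs" "drop n xs"] by simp

lemma size_enc_Pair: "size (enc p) = size (enc (fst p)) + size (enc (snd p)) + 1"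
  by (simp add: enc_prod_def)

lemma size_enc_bool: "size (enc (b :: bool)) \<le> 1"
  by (simp add: enc_bool_def)

lemma enc_0 [simp]: "enc (0 :: nat) = Leaf"
  by (simp add: enc_nat_def enc_nat.simps[of 0])

lemma enc_nat_rec: "n > 0 \<Longrightarrow> enc (n :: nat) = Node (enc (odd n)) (enc (n div 2))"
  by (simp add: enc_nat_def enc_nat.simps[of n] enc_bool_def)

lemma size_enc_hd0: "size (enc (hd0 xs)) \<le> size (enc xs)"
  by (cases xs) (auto simp: hd0_def)

text \<open>A number and its bit list have the same encoding, so numbers can be compared by list
  functions.\<close>

fun bits :: "nat \<Rightarrow> bool list" where
  "bits n = (if n = 0 then [] else odd n # bits (n div 2))"

declare bits.simps [simp del]

lemma enc_bits: "enc (bits n) = enc n"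
proof (induction n rule: bits.induct)
  case (1 n)
  then show ?case
    by (cases "n = 0") (simp_all add: bits.simps[of n] bits.simps[of 0] enc_nat_rec)
qed

lemma bits_inject: "bits m = bits n \<longleftrightarrow> m = n"
proof
  show "bits m = bits n \<Longrightarrow> m = n"
  proof (induction m arbitrary: n rule: bits.induct)
    case (1 m)
    show ?case
    proof (cases "m = 0 \<or> n = 0")
      case True
      then show ?thesis using 1(2) by (auto simp: bits.simps[of m] bits.simps[of n] split: if_splits)
    next
      case False
      then have "odd m = odd n" "bits (m div 2) = bits (n div 2)"
        using 1(2) by (auto simp: bits.simps[of m] bits.simps[of n])
      then have "m mod 2 = n mod 2" "m div 2 = n div 2"
        using 1(1) False by (auto simp: odd_iff_mod_2_eq_one even_iff_mod_2_eq_zero)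
      then show ?thesis by (metis div_mult_mod_eq)
    qed
  qed
qed simp

lemma pt_on_bits [pt_intros]: "pt_on A f \<Longrightarrow> pt_on A (\<lambda>x. bits (f x))"
  by (erule pt_on_coerce) (rule enc_bits)

definition hd_true :: "bool list \<Rightarrow> bool" where
  "hd_true xs = (case xs of [] \<Rightarrow> False | b # _ \<Rightarrow> b)"

lemma pt_on_hd_true [pt_intros]: "pt_on A f \<Longrightarrow> pt_on A (\<lambda>x. hd_true (f x))"
  by (erule pt_on_left) (simp add: hd_true_def split: list.split)

lemma pt_on_hd0 [pt_intros]: "pt_on A f \<Longrightarrow> pt_on A (\<lambda>x. hd0 (f x))"
  by (erule pt_on_left) (simp add: hd0_def split: list.split)

text \<open>The state holds the unread bits of the other number and whether all bits agreed so far;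
  \<open>c\<close> is a dummy environment.\<close>

definition bits_step :: "bool \<Rightarrow> bool \<Rightarrow> bool list \<times> bool \<Rightarrow> bool list \<times> bool" where
  "bits_step c b s = (tl (fst s), snd s \<and> fst s \<noteq> [] \<and> (if b then hd_true (fst s) else \<not> hd_true (fst s)))"

lemma pt_on_nat_eq [pt_intros]:
  fixes f g :: "'a :: enc \<Rightarrow> nat"
  assumes "pt_on A f" "pt_on A g"
  shows "pt_on A (\<lambda>x. f x = g x)"
proof -
  have "fold (bits_step c) xs (ys, b) = (drop (length xs) ys, b \<and> take (length xs) ys = xs)" for c xs ys b
    by (induction xs arbitrary: ys b)
      (auto simp: bits_step_def hd_true_def drop_Suc take_Suc split: list.splits)
  then have *: "fst s = [] \<and> snd s \<longleftrightarrow> xs = ys" if "s = fold (bits_step c) xs (ys, True)" for s c xs ys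
    using that by auto
  have "pt_on A (\<lambda>x. fold (bits_step False) (bits (f x)) (bits (g x), True))"
  proof (rule pt_on_fold_add[where f = bits_step and c = "\<lambda>_. False" and q = "[:1:]"])
    fix c x s
    have "size (enc (bits_step c x s)) = size (enc (tl (fst s))) + size (enc (snd (bits_step c x s))) + 1"
      by (simp add: bits_step_def enc_prod_def)
    then show "size (enc (bits_step c x s)) \<le> size (enc s) + poly [:1:] (size (enc c) + size (enc x))"
      using size_enc_tl[of "fst s"] size_enc_bool[of "snd (bits_step c x s)"] size_enc_Pair[of s] by simp
  next
    show "pt (\<lambda>p. bits_step (fst p) (fst (snd p)) (snd (snd p)))"
      unfolding bits_step_def by (intro pt_intros)
  qed (intro pt_intros assms)+
  then have "pt_on A (\<lambda>x. fst (fold (bits_step False) (bits (f x)) (bits (g x), True)) = [] \<and>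
      snd (fold (bits_step False) (bits (f x)) (bits (g x), True)))"
    by (intro pt_intros)
  then show ?thesis
    by (rule pt_on_coerce) (use * bits_inject in auto)
qed

lemma pt_on_drop [pt_intros]:
  fixes m :: "'a :: enc \<Rightarrow> 'b :: enc list" and xs :: "'a :: enc \<Rightarrow> 'c :: enc list"
  assumes "pt_on A m" "pt_on A xs"
  shows "pt_on A (\<lambda>x. drop (length (m x)) (xs x))"
proof -
  have *: "fold (\<lambda>_. tl) (m :: 'b list) (xs :: 'c list) = drop (length m) xs" for m xs
    by (induction m arbitrary: xs) (auto simp: drop_Suc)
  have "pt_on A (\<lambda>x. fold ((\<lambda>_ _. tl) False) (m x) (xs x))"
  proof (rule pt_on_fold_add[where q = 0])
    show "pt (\<lambda>p :: bool \<times> 'b \<times> 'c list. tl (snd (snd p)))" by (intro pt_intros)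
  qed (use size_enc_tl in \<open>auto intro: pt_intros assms\<close>)
  then show ?thesis by (simp add: *)
qed

lemma pt_on_fold_Cons [pt_intros]:
  fixes xs ys :: "'a :: enc \<Rightarrow> 'b :: enc list"
  assumes "pt_on A xs" "pt_on A ys"
  shows "pt_on A (\<lambda>x. fold Cons (xs x) (ys x))"
proof -
  have "pt_on A (\<lambda>x. fold ((\<lambda>_. Cons) False) (xs x) (ys x))"
  proof (rule pt_on_fold_add[where q = "[:1, 1:]"])
    show "pt (\<lambda>p :: bool \<times> 'b \<times> 'b list. fst (snd p) # snd (snd p))" by (intro pt_intros)
  qed (auto intro: pt_intros assms)
  then show ?thesis by simp
qed

lemma fold_Cons: "fold Cons xs ys = rev xs @ ys"
  by (induction xs arbitrary: ys) auto

lemma pt_on_rev [pt_intros]: "pt_on A xs \<Longrightarrow> pt_on A (\<lambda>x. rev (xs x))"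
  using pt_on_fold_Cons[OF _ pt_on_const[of A "[]"], of xs] by (simp add: fold_Cons)

lemma pt_on_Tm [pt_intros]: "pt_on A f \<Longrightarrow> pt_on A (\<lambda>x. Tm (f x))"
  by (rule pt_on_tree2[OF pt_on_const[of A True]]) auto

lemma pt_on_member [pt_intros]:
  fixes a :: "'a :: enc \<Rightarrow> nat"
  assumes "pt_on A a" "pt_on A xs"
  shows "pt_on A (\<lambda>x. a x \<in> set (xs x))"
proof -
  have *: "fold (\<lambda>x b. if x = a then True else b) xs b \<longleftrightarrow> b \<or> a \<in> set xs" for a :: nat and xs b
    by (induction xs arbitrary: b) auto
  have "pt_on A (\<lambda>x. fold ((\<lambda>a x b. if x = a then True else b) (a x)) (xs x) False)"
  proof (rule pt_on_fold_add[where q = "[:1:]"])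
    show "pt (\<lambda>p :: nat \<times> nat \<times> bool. if fst (snd p) = fst p then True else snd (snd p))"
      by (intro pt_intros)
  qed (auto intro: pt_intros assms)
  then show ?thesis by (simp add: *)
qed

section \<open>The encoding of the input word\<close>

definition letters :: "nat list \<Rightarrow> nat list" where
  "letters w = rev (fold List.insert w [])"

lemma set_letters: "set (letters w) = set w"
  and distinct_letters: "distinct (letters w)"
proof -
  have "set (fold List.insert w xs) = set w \<union> set xs" for xs
    by (induction w arbitrary: xs) auto
  then show "set (letters w) = set w" by (simp add: letters_def)
  have "distinct xs \<Longrightarrow> distinct (fold List.insert w xs)" for xs
    by (induction w arbitrary: xs) auto
  then show "distinct (letters w)" by (simp add: letters_def)
qed

lemma pt_on_letters [pt_intros]:
  assumes "pt_on A w"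
  shows "pt_on A (\<lambda>x. letters (w x))"
proof -
  have "pt_on A (\<lambda>x. fold ((\<lambda>_ :: bool. List.insert) False) (w x) [])"
  proof (rule pt_on_fold_add[where q = "[:1, 1:]"])
    show "pt (\<lambda>p :: bool \<times> nat \<times> nat list. List.insert (fst (snd p)) (snd (snd p)))"
      unfolding List.insert_def by (intro pt_intros)
  qed (auto intro: pt_intros assms simp: List.insert_def)
  then show ?thesis unfolding letters_def by (intro pt_intros)
qed

text \<open>Run over the letters backwards, this yields the code without computing an index: nothing
  until the letter is met, then 2, then a 1 for each entry in front of it.\<close>

definition code_step :: "nat \<Rightarrow> nat \<Rightarrow> nat list \<Rightarrow> nat list" where
  "code_step a x s = (if s = [] then (if x = a then [2] else []) else 1 # s)"

definition letter_code :: "nat list \<Rightarrow> nat \<Rightarrow> nat list" where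
  "letter_code d a = fold (code_step a) (rev d) []"

lemma letter_code_eq:
  assumes "a \<in> set d"
  shows "\<exists>i<length d. d ! i = a \<and> letter_code d a = unary_code i"
  using assms
proof (induction d)
  case (Cons x d)
  have step: "letter_code (x # d) a = code_step a x (letter_code d a)"
    by (simp add: letter_code_def)
  show ?case
  proof (cases "a \<in> set d")
    case True
    then obtain i where i: "i < length d" "d ! i = a" "letter_code d a = unary_code i"
      using Cons.IH by blast
    then show ?thesis
      by (intro exI[of _ "Suc i"]) (auto simp: step code_step_def unary_code_Suc, simp add: unary_code_def)
  next
    case False
    have "fold (code_step a) xs [] = []" if "a \<notin> set xs" for xs
      using that by (induction xs) (auto simp: code_step_def)
    then have "letter_code d a = []" using False by (simp add: letter_code_def)
    then show ?thesis using Cons.prems False unfolding step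
      by (intro exI[of _ 0]) (auto simp: code_step_def unary_code_0)
  qed
qed simp

lemma pt_on_letter_code [pt_intros]:
  assumes "pt_on A d" "pt_on A a"
  shows "pt_on A (\<lambda>x. letter_code (d x) (a x))"
  unfolding letter_code_def
\<comment> \<open>A step adds at most one entry, a 1 or a 2, and its list cell takes fewer than 10
  nodes.\<close>
proof (rule pt_on_fold_add[where q = "[:10:]"])
  show "pt (\<lambda>p. code_step (fst p) (fst (snd p)) (snd (snd p)))"
    unfolding code_step_def by (intro pt_intros)
  have "size (enc (1 :: nat)) \<le> 2" "size (enc (2 :: nat)) \<le> 3"
    using enc_nat_rec[of 1] enc_nat_rec[of 2] by simp_all
  then show "size (enc (code_step c x s)) \<le> size (enc s) + poly [:10:] (size (enc c) + size (enc x))" for c x s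
    by (simp add: code_step_def)
qed (intro pt_intros assms)+

definition binary_word :: "nat list \<Rightarrow> nat list" where
  "binary_word w = rev (fold (\<lambda>a. fold Cons (letter_code (letters w) a)) w [])"

text \<open>Serves the proof only; the program computes \<open>letter_code\<close>. The value 0
  outside \<open>d\<close> keeps every index below the length of a nonempty \<open>d\<close>, as
  \<open>encode_grammar\<close> is analysed for total index functions.\<close>

definition letter_index :: "nat list \<Rightarrow> nat \<Rightarrow> nat" where
  "letter_index d a = (if a \<in> set d
     then SOME i. i < length d \<and> d ! i = a \<and> letter_code d a = unary_code i else 0)"

lemma letter_index:
  assumes "a \<in> set d"
  shows "letter_index d a < length d" "d ! letter_index d a = a"
    "letter_code d a = unary_code (letter_index d a)"
  using someI_ex[OF letter_code_eq[OF assms]] assms by (simp_all add: letter_index_def)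

lemma binary_word_eq: "binary_word w = encode_word (letter_index (letters w)) w"
proof -
  have "rev (fold (\<lambda>a. fold Cons (f a)) w s) = rev s @ concat (map f w)" for f :: "nat \<Rightarrow> nat list" and w s
    by (induction w arbitrary: s) (auto simp: fold_Cons)
  then have "binary_word w = concat (map (letter_code (letters w)) w)"
    by (simp add: binary_word_def)
  also have "map (letter_code (letters w)) w = map (\<lambda>a. unary_code (letter_index (letters w) a)) w"
    by (intro map_cong) (auto simp: letter_index(3) set_letters)
  finally show ?thesis by (simp add: encode_word_def)
qed

lemma pt_on_binary_word [pt_intros]:
  assumes "pt_on A w"
  shows "pt_on A (\<lambda>x. binary_word (w x))"
proof -
  have code: "pt (\<lambda>p. letter_code (fst p) (snd p))" by (intro pt_intros)
  obtain b where b: "\<And>p. size (enc (letter_code (fst p) (snd p))) \<le> poly b (size (enc p))"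
    using pt_on_size[OF code] by auto
  have "pt_on A (\<lambda>x. fold ((\<lambda>d a. fold Cons (letter_code d a)) (letters (w x))) (w x) [])"
  proof (rule pt_on_fold_add[where q = "pcompose b [:1, 1:]"])
    show "pt (\<lambda>p. fold Cons (letter_code (fst p) (fst (snd p))) (snd (snd p)))" by (intro pt_intros)
    fix c a s
    have "size (enc (letter_code c a)) \<le> poly b (size (enc c) + size (enc a) + 1)"
      using b[of "(c, a)"] by (simp add: size_enc_Pair)
    moreover have "size (enc (rev xs)) = size (enc xs)" for xs :: "nat list"
      by (induction xs) (auto simp: size_enc_append)
    ultimately show "size (enc (fold Cons (letter_code c a) s)) \<le>
        size (enc s) + poly (pcompose b [:1, 1:]) (size (enc c) + size (enc a))"
      by (simp add: fold_Cons size_enc_append poly_pcompose add.commute)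
  qed (intro pt_intros assms)+
  then show ?thesis unfolding binary_word_def by (intro pt_intros)
qed


section \<open>The table of summaries\<close>

definition is_Tm :: "sym \<Rightarrow> bool" where
  "is_Tm X = (case X of NT _ \<Rightarrow> False | Tm _ \<Rightarrow> True)"

definition sym_index :: "sym \<Rightarrow> nat" where
  "sym_index X = (case X of NT A \<Rightarrow> A | Tm a \<Rightarrow> a)"

lemma pt_on_is_Tm [pt_intros]: "pt_on A f \<Longrightarrow> pt_on A (\<lambda>x. is_Tm (f x))"
  by (erule pt_on_left) (simp add: is_Tm_def split: sym.split)

lemma pt_on_sym_index [pt_intros]: "pt_on A f \<Longrightarrow> pt_on A (\<lambda>x. sym_index (f x))"
  by (erule pt_on_right) (simp add: sym_index_def split: sym.split)

definition lookup_step :: "nat \<Rightarrow> nat \<times> info \<Rightarrow> info \<Rightarrow> info" where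
  "lookup_step A e i = (if fst e = A then snd e else i)"

text \<open>The default is the summary that every nonterminal has in the first round, when the table
  is still empty.\<close>

definition lookup :: "(nat \<times> info) list \<Rightarrow> nat \<Rightarrow> info" where
  "lookup T A = fold (lookup_step A) T ([], [], [])"

lemma lookup_eq: "distinct (map fst T) \<Longrightarrow> (A, i) \<in> set T \<Longrightarrow> lookup T A = i"
  by (induction T rule: rev_induct) (force simp: lookup_def lookup_step_def)+

lemma lookup_cases: "lookup T A = ([], [], []) \<or> lookup T A \<in> snd ` set T"
  by (induction T rule: rev_induct) (auto simp: lookup_def lookup_step_def)

lemma pt_on_lookup [pt_intros]:
  assumes "pt_on A T" "pt_on A B"
  shows "pt_on A (\<lambda>x. lookup (T x) (B x))"
  unfolding lookup_def
proof (rule pt_on_fold_add[where q = "[:0, 1:]"])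
  show "pt (\<lambda>p. lookup_step (fst p) (fst (snd p)) (snd (snd p)))"
    unfolding lookup_step_def by (intro pt_intros)
  show "size (enc (lookup_step c x s)) \<le> size (enc s) + poly [:0, 1:] (size (enc c) + size (enc x))" for c x s
    by (simp add: lookup_step_def size_enc_Pair[of x])
qed (intro pt_intros assms)+

lemma pt_on_sym_info [pt_intros]:
  assumes "pt_on A d" "pt_on A T" "pt_on A X"
  shows "pt_on A (\<lambda>x. sym_info (d x) (lookup (T x)) (X x))"
proof -
  have *: "sym_info d L X = (if is_Tm X then if sym_index X = 1 then ([0], [], []) else ([], d, [Tm 0])
      else L (sym_index X))" for d L X
    by (cases X) (auto simp: is_Tm_def sym_index_def)
  show ?thesis unfolding * by (intro pt_intros assms)
qed

text \<open>Projections in place of pattern matching, so that the rules \<open>pt_intros\<close>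
  apply.\<close>

lemma scan_step_eq: "scan_step d L X s =
  (let i = sym_info d L X; c' = drop (length (fst i)) (fst (snd s)); 
       f' = (if snd (snd s) = [] then c' else fst s)
   in if snd (snd i) = [] then (f', c', snd (snd s))
      else (f', fst (snd i), if tl (snd (snd i)) = [] then Tm (hd0 c') # snd (snd s)
         else X # Tm (hd0 c') # snd (snd s)))"
  by (cases s) (simp add: Let_def split_def)

lemma pt_scan_step:
  "pt (\<lambda>p. scan_step (fst (fst p)) (lookup (snd (fst p))) (fst (snd p)) (snd (snd p)))"
  unfolding scan_step_eq Let_def by (intro pt_intros)

text \<open>Only the middle component of a looked-up summary is ever copied into the state; the
  others are merely measured or tested for emptiness. So their sizes do not enter the bound.\<close>

lemma size_scan:
  assumes L: "\<And>A. size (enc (fst (snd (L A)))) \<le> M" and d: "size (enc d) \<le> M"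
    and s: "size (enc (fst s)) \<le> M" "size (enc (fst (snd s))) \<le> M"
  shows "size (enc (fst (fold (scan_step d L) \<alpha> s))) \<le> M \<and>
    size (enc (fst (snd (fold (scan_step d L) \<alpha> s)))) \<le> M \<and>
    size (enc (snd (snd (fold (scan_step d L) \<alpha> s)))) \<le>
      size (enc (snd (snd s))) + size (enc \<alpha>) + length \<alpha> * (M + 5)"
  using s
proof (induction \<alpha> arbitrary: s)
  case (Cons X \<alpha>)
  let ?s = "scan_step d L X s"
  have i: "size (enc (fst (snd (sym_info d L X)))) \<le> M"
    using L d by (cases X) auto
  have c: "size (enc (drop n (fst (snd s)))) \<le> M" for n
    using size_enc_drop le_trans Cons.prems(2) by blast
  have h: "size (enc (hd0 (drop n (fst (snd s))))) \<le> M" for n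
    using size_enc_hd0 le_trans c by blast
  have "size (enc (fst ?s)) \<le> M" "size (enc (fst (snd ?s))) \<le> M"
    using i c Cons.prems unfolding scan_step_eq Let_def by auto
  moreover have "size (enc (snd (snd ?s))) \<le> size (enc (snd (snd s))) + size (enc X) + (M + 5)"
    using h[of "length (fst (sym_info d L X))"] unfolding scan_step_eq Let_def by simp
  ultimately show ?case using Cons.IH[of ?s] by simp
qed simp

lemma pt_on_rhs_info [pt_intros]:
  assumes "pt_on A d" "pt_on A T" "pt_on A \<alpha>"
  shows "pt_on A (\<lambda>x. rhs_info (d x) (lookup (T x)) (\<alpha> x))"
proof -
  let ?F = "\<lambda>d T \<alpha>. fold (scan_step d (lookup T)) \<alpha> (d, d, [])"
  let ?f = "\<lambda>c :: nat list \<times> (nat \<times> info) list. scan_step (fst c) (lookup (snd c))"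
  let ?h = "\<lambda>n. (n + n) + (n + n) + (n + (n * (n + n + 5)) + 2)"
  have mem: "size (enc (fst (snd (lookup T B)))) \<le> size (enc T)" for T B
  proof -
    have "size (enc (fst (snd (snd e)))) \<le> size (enc T)" if "e \<in> set T" for e and T :: "(nat \<times> info) list"
      using that by (induction T) (auto simp: size_enc_Pair)
    then show ?thesis using lookup_cases[of T B] by auto
  qed
  have "pt (\<lambda>p. fold (?f (fst p)) (snd p) (fst (fst p), fst (fst p), []))"
  \<comment> \<open>A step is not additive in size, since \<open>f\<close> may become a copy of
    \<open>c\<close>; the bound comes from \<open>size_scan\<close>.\<close>
  proof (rule pt_on_fold[where h = ?h])
    show "pt (\<lambda>p. ?f (fst p) (fst (snd p)) (snd (snd p)))" by (rule pt_scan_step)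
    show "poly_bounded ?h" by (intro pb_intros)
    fix a :: "(nat list \<times> (nat \<times> info) list) \<times> sym list" and ys zs
    assume a: "snd a = ys @ zs"
    let ?d = "fst (fst a)" let ?T = "snd (fst a)" let ?n = "size (enc a)"
    let ?M = "size (enc ?d) + size (enc ?T)"
    let ?s = "fold (?f (fst a)) ys (?d, ?d, [])"
    have M: "?M \<le> ?n" "size (enc ys) \<le> ?n"
      by (simp_all add: size_enc_Pair a size_enc_append)
    have *: "size (enc (fst ?s)) \<le> ?M \<and> size (enc (fst (snd ?s))) \<le> ?M \<and>
      size (enc (snd (snd ?s))) \<le> size (enc (snd (snd (?d, ?d, [] :: sym list)))) + size (enc ys) + length ys * (?M + 5)"
      by (rule size_scan) (use mem[of ?T] in \<open>auto intro: trans_le_add2\<close>)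
    have "length ys * (?M + 5) \<le> ?n * (?n + ?n + 5)"
      using length_le_size_enc[of ys] M by (intro mult_mono) auto
    then show "size (enc ?s) \<le> ?h ?n" using * M
      by (simp only: size_enc_Pair) simp
  qed (intro pt_intros)+
  moreover have "pt_on A (\<lambda>x. ((d x, T x), \<alpha> x))" by (intro pt_intros assms)
  ultimately have F: "pt_on A (\<lambda>x. ?F (d x) (T x) (\<alpha> x))"
    by (auto dest: pt_comp)
  show ?thesis unfolding rhs_info_def split_def by (intro pt_intros F assms)
qed

definition update_table_step :: "nat list \<times> (nat \<times> info) list \<Rightarrow> nat \<times> sym list \<Rightarrow> (nat \<times> info) list \<Rightarrow> (nat \<times> info) list" where
  "update_table_step c p acc = (fst p, rhs_info (fst c) (lookup (snd c)) (snd p)) # acc"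

definition update_table :: "nat list \<Rightarrow> (nat \<times> sym list) list \<Rightarrow> (nat \<times> info) list \<Rightarrow> (nat \<times> info) list" where
  "update_table d ps T = fold (update_table_step (d, T)) ps []"

lemma update_table_eq: "update_table d ps T = rev (map (\<lambda>p. (fst p, rhs_info d (lookup T) (snd p))) ps)"
proof -
  have "fold (update_table_step (d, T)) ps acc = rev (map (\<lambda>p. (fst p, rhs_info d (lookup T) (snd p))) ps) @ acc" for acc
    by (induction ps arbitrary: acc) (auto simp: update_table_step_def)
  then show ?thesis by (simp add: update_table_def)
qed

lemma pt_on_update_table [pt_intros]:
  assumes "pt_on A d" "pt_on A ps" "pt_on A T"
  shows "pt_on A (\<lambda>x. update_table (d x) (ps x) (T x))"
proof -
  let ?r = "\<lambda>p :: (nat list \<times> (nat \<times> info) list) \<times> nat \<times> sym list.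
      rhs_info (fst (fst p)) (lookup (snd (fst p))) (snd (snd p))"
  have r: "pt ?r" by (intro pt_intros)
  obtain b where b: "\<And>p. p \<in> UNIV \<Longrightarrow> size (enc (?r p)) \<le> poly b (size (enc p))"
    using pt_on_size[OF r] by blast
  show ?thesis unfolding update_table_def
  proof (rule pt_on_fold_add[where f = update_table_step and q = "[:2, 1:] + pcompose b [:1, 1:]"])
    show "pt (\<lambda>p. update_table_step (fst p) (fst (snd p)) (snd (snd p)))"
      unfolding update_table_step_def by (intro pt_intros)
    fix c s and p :: "nat \<times> sym list"
    have "size (enc (rhs_info (fst c) (lookup (snd c)) (snd p))) \<le> poly b (size (enc c) + size (enc p) + 1)"
      using b[of "(c, p)"] by (simp add: size_enc_Pair)
    then show "size (enc (update_table_step c p s)) \<le> size (enc s) + poly ([:2, 1:] + pcompose b [:1, 1:]) (size (enc c) + size (enc p))"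
      by (simp add: update_table_step_def poly_pcompose size_enc_Pair[of p] add.commute)
  qed (intro pt_intros assms)+
qed

text \<open>The list \<open>ps\<close> serves twice: as the productions and as the counter of the
  rounds.\<close>

definition table :: "nat list \<Rightarrow> (nat \<times> sym list) list \<Rightarrow> (nat \<times> info) list" where
  "table d ps = fold (\<lambda>_. update_table d ps) ps []"

text \<open>The bound for the new table depends on \<open>d\<close> and \<open>ps\<close> but not on
  the size of the old table, so growth does not accumulate over the rounds.\<close>

lemma size_update_table:
  assumes "\<forall>e\<in>set T. size (enc (fst (snd (snd e)))) \<le> size (enc d)"
  shows "\<forall>e\<in>set (update_table d ps T). size (enc (fst (snd (snd e)))) \<le> size (enc d)"
    and "size (enc (update_table d ps T)) \<le>
      size (enc ps) * (size (enc ps) * (size (enc d) + 7) + 2 * size (enc d) + 5)"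
proof -
  let ?D = "size (enc d)"
  have L: "size (enc (fst (snd (lookup T A)))) \<le> ?D" for A
    using lookup_cases[of T A] assms by auto
  have s: "size (enc (fst (rhs_info d (lookup T) \<alpha>))) \<le> ?D"
    "size (enc (fst (snd (rhs_info d (lookup T) \<alpha>)))) \<le> ?D"
    "size (enc (snd (snd (rhs_info d (lookup T) \<alpha>)))) \<le> size (enc \<alpha>) + length \<alpha> * (?D + 5)" for \<alpha>
  proof -
    have rev: "size (enc (rev xs)) = size (enc xs)" for xs :: "sym list"
      by (induction xs) (auto simp: size_enc_append)
    show "size (enc (fst (rhs_info d (lookup T) \<alpha>))) \<le> ?D"
    "size (enc (fst (snd (rhs_info d (lookup T) \<alpha>)))) \<le> ?D"
    "size (enc (snd (snd (rhs_info d (lookup T) \<alpha>)))) \<le> size (enc \<alpha>) + length \<alpha> * (?D + 5)"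
      using size_scan[of "lookup T" ?D d "(d, d, [])" \<alpha>, OF L] size_enc_drop
      by (simp_all add: rhs_info_def split_def rev)
  qed
  show "\<forall>e\<in>set (update_table d ps T). size (enc (fst (snd (snd e)))) \<le> ?D"
    using s(2) by (auto simp: update_table_eq)
  have e: "size (enc (fst p, rhs_info d (lookup T) (snd p))) \<le> size (enc p) * (?D + 7) + 2 * ?D + 4" for p
  proof -
    have "length (snd p) * (?D + 5) \<le> size (enc p) * (?D + 5)"
      using length_le_size_enc[of "snd p"] by (intro mult_right_mono) (auto simp: size_enc_Pair)
    then show ?thesis using s[of "snd p"] size_enc_Pair[of p]
      by (simp add: size_enc_Pair[of "rhs_info d (lookup T) (snd p)"]
         size_enc_Pair[of "snd (rhs_info d (lookup T) (snd p))"] algebra_simps)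
  qed
  have "size (enc (rev (map (\<lambda>p. (fst p, rhs_info d (lookup T) (snd p))) qs))) \<le>
      length qs * (N * (?D + 7) + 2 * ?D + 5)" if "\<forall>p\<in>set qs. size (enc p) \<le> N" for qs N
    using that
  proof (induction qs)
    case (Cons p qs)
    have "size (enc p) * (?D + 7) \<le> N * (?D + 7)" using Cons.prems by (intro mult_right_mono) auto
    then have "size (enc (fst p, rhs_info d (lookup T) (snd p))) \<le> N * (?D + 7) + 2 * ?D + 4"
      using e[of p] by linarith
    then show ?case using Cons by (simp add: size_enc_append)
  qed simp
  moreover have "\<forall>p\<in>set ps. size (enc p) \<le> size (enc ps)" by (induction ps) auto
  ultimately have "size (enc (update_table d ps T)) \<le> length ps * (size (enc ps) * (?D + 7) + 2 * ?D + 5)"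
    unfolding update_table_eq by blast
  also have "\<dots> \<le> size (enc ps) * (size (enc ps) * (?D + 7) + 2 * ?D + 5)"
    using length_le_size_enc by (intro mult_right_mono) auto
  finally show "size (enc (update_table d ps T)) \<le> size (enc ps) * (size (enc ps) * (?D + 7) + 2 * ?D + 5)" .
qed

lemma pt_on_table [pt_intros]:
  assumes "pt_on A d" "pt_on A ps"
  shows "pt_on A (\<lambda>x. table (d x) (ps x))"
proof -
  let ?f = "\<lambda>c (_ :: nat \<times> sym list). update_table (fst c) (snd c)"
  let ?h = "\<lambda>n. n * (n * (n + 7) + 2 * n + 5)"
  have "pt (\<lambda>c. fold (?f c) (snd c) [])"
  proof (rule pt_on_fold[where h = ?h and f = ?f and c = "\<lambda>c. c"])
    show "pt (\<lambda>p. ?f (fst p) (fst (snd p)) (snd (snd p)))" by (intro pt_intros)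
    show "poly_bounded ?h" by (intro pb_intros)
    fix a :: "nat list \<times> (nat \<times> sym list) list" and ys zs
    assume "snd a = ys @ zs"
    let ?d = "fst a" let ?ps = "snd a"
    have "(\<forall>e\<in>set (fold (?f a) ys []). size (enc (fst (snd (snd e)))) \<le> size (enc ?d)) \<and>
      size (enc (fold (?f a) ys [])) \<le> size (enc ?ps) * (size (enc ?ps) * (size (enc ?d) + 7) + 2 * size (enc ?d) + 5)"
      by (induction ys rule: rev_induct) (auto dest: size_update_table)
    then have "size (enc (fold (?f a) ys [])) \<le> size (enc ?ps) * (size (enc ?ps) * (size (enc ?d) + 7) + 2 * size (enc ?d) + 5)"
      by blast
    also have "\<dots> \<le> ?h (size (enc a))"
      by (intro mult_mono add_mono) (auto simp: size_enc_Pair)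
    finally show "size (enc (fold (?f a) ys [])) \<le> ?h (size (enc a))" .
  qed (intro pt_intros)+
  from pt_comp[OF this, of A "\<lambda>x. (d x, ps x)"] show ?thesis
    unfolding table_def using assms by (auto intro: pt_intros)
qed

section \<open>Output of the decoded productions and correctness of the table\<close>

definition output_step :: "nat \<Rightarrow> nat \<times> info \<Rightarrow> (nat \<times> sym list) list \<Rightarrow> (nat \<times> sym list) list" where
  "output_step S e acc =
     (let r = (if fst e = S then snd (snd (snd e)) else tl (snd (snd (snd e))))
      in if r = [] then acc else (fst e, r) # acc)"

definition output_productions :: "(nat \<times> info) list \<Rightarrow> nat \<Rightarrow> (nat \<times> sym list) list" where
  "output_productions T S = fold (output_step S) T []"

lemma pt_on_output_productions [pt_intros]:
  assumes "pt_on A T" "pt_on A S"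
  shows "pt_on A (\<lambda>x. output_productions (T x) (S x))"
  unfolding output_productions_def
proof (rule pt_on_fold_add[where f = output_step and q = "[:2, 1:]"])
  show "pt (\<lambda>p. output_step (fst p) (fst (snd p)) (snd (snd p)))"
    unfolding output_step_def Let_def by (intro pt_intros)
  show "size (enc (output_step c e s)) \<le> size (enc s) + poly [:2, 1:] (size (enc c) + size (enc e))" for c e s
    using size_enc_tl[of "snd (snd (snd e))"] size_enc_Pair[of e] size_enc_Pair[of "snd e"] size_enc_Pair[of "snd (snd e)"]
    by (simp add: output_step_def Let_def)
qed (intro pt_intros assms)+

lemma output_productions_eq:
  assumes "distinct (map fst T)"
  shows "set (output_productions T S) =
      {(A, decoded_rhs S (lookup T) A) | A. A \<in> fst ` set T \<and> decoded_rhs S (lookup T) A \<noteq> []}"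
    and "distinct (output_productions T S)"
proof -
  let ?r = "\<lambda>e :: nat \<times> info. if fst e = S then snd (snd (snd e)) else tl (snd (snd (snd e)))"
  have "fold (output_step S) T acc = rev (map (\<lambda>e. (fst e, ?r e)) (filter (\<lambda>e. ?r e \<noteq> []) T)) @ acc" for acc
    by (induction T arbitrary: acc) (auto simp: output_step_def Let_def)
  then have eq: "output_productions T S = rev (map (\<lambda>e. (fst e, ?r e)) (filter (\<lambda>e. ?r e \<noteq> []) T))"
    by (simp add: output_productions_def)
  have r: "decoded_rhs S (lookup T) (fst e) = ?r e" if "e \<in> set T" for e
    using lookup_eq[OF assms, of "fst e" "snd e"] that by (auto simp: decoded_rhs_def)
  show "set (output_productions T S) =
      {(A, decoded_rhs S (lookup T) A) | A. A \<in> fst ` set T \<and> decoded_rhs S (lookup T) A \<noteq> []}"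
  proof -
    have "set (output_productions T S) = (\<lambda>e. (fst e, ?r e)) ` {e \<in> set T. ?r e \<noteq> []}"
      by (simp add: eq)
    also have "\<dots> = (\<lambda>e. (fst e, decoded_rhs S (lookup T) (fst e))) ` {e \<in> set T. decoded_rhs S (lookup T) (fst e) \<noteq> []}"
      by (intro image_cong Collect_cong conj_cong refl) (simp_all add: r)
    also have "\<dots> = {(A, decoded_rhs S (lookup T) A) | A. A \<in> fst ` set T \<and> decoded_rhs S (lookup T) A \<noteq> []}"
      by blast
    finally show ?thesis .
  qed
  have "distinct (map fst (filter (\<lambda>e. ?r e \<noteq> []) T))" using assms by (rule distinct_map_filter)
  then have "distinct (map fst (map (\<lambda>e. (fst e, ?r e)) (filter (\<lambda>e. ?r e \<noteq> []) T)))"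
    by (simp add: comp_def)
  then show "distinct (output_productions T S)"
    unfolding eq distinct_rev distinct_map[of fst] by blast
qed

lemma fst_table:
  assumes "distinct (map fst ps)"
  shows "fst ` set (table d ps) = fst ` set ps" and "distinct (map fst (table d ps))"
proof -
  have *: "fst ` set (update_table d ps T) = fst ` set ps \<and> distinct (map fst (update_table d ps T))" for T
    using assms by (auto simp: update_table_eq comp_def image_image simp flip: rev_map)
  have "fst ` set (table d ps) = fst ` set ps \<and> distinct (map fst (table d ps))"
  proof (cases ps rule: rev_cases)
    case (snoc qs q)
    have "table d ps = update_table d ps (fold (\<lambda>_. update_table d ps) qs [])"
      unfolding table_def snoc by simp
    then show ?thesis using * by metis
  qed (simp add: table_def)
  then show "fst ` set (table d ps) = fst ` set ps" "distinct (map fst (table d ps))" by blast+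
qed

lemma lookup_table:
  assumes "distinct (map fst ps)" "slp G" "set ps = productions G" "(A, \<alpha>) \<in> productions G"
  shows "lookup (table d ps) A = rhs_info d (lookup (table d ps)) \<alpha>"
proof -
  define L where "L = (\<lambda>r. lookup ((update_table d ps ^^ r) []))"
  have "fold (\<lambda>_. f) ys x = (f ^^ length ys) x" for f and x :: "(nat \<times> info) list"
      and ys :: "(nat \<times> sym list) list"
    by (induction ys arbitrary: x) (auto simp: funpow_swap1)
  then have L: "lookup (table d ps) = L (length ps)" by (simp add: L_def table_def)
  have "L (length ps) A = rhs_info d (L (length ps)) \<alpha>"
  proof (rule slp_iterate_fixpoint[OF assms(2) _ _ _ assms(4)])
    fix r A \<alpha> assume "(A, \<alpha>) \<in> productions G"
    then have "(A, rhs_info d (L r) \<alpha>) \<in> set (update_table d ps ((update_table d ps ^^ r) []))"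
      using assms(3) by (force simp: update_table_eq L_def)
    moreover have "distinct (map fst (update_table d ps T))" for T
      using assms(1) by (simp add: update_table_eq comp_def flip: rev_map)
    ultimately show "L (Suc r) A = rhs_info d (L r) \<alpha>" using lookup_eq by (simp add: L_def)
  next
    show "rhs_info d f \<beta> = rhs_info d g \<beta>" if "\<And>B. NT B \<in> set \<beta> \<Longrightarrow> f B = g B" for f g \<beta>
      using that by (rule rhs_info_cong)
    \<comment> \<open>Every nonterminal has a production, so \<open>length ps\<close> rounds are
      enough to reach the fixpoint.\<close>
    have "nonterminals G \<subseteq> fst ` set ps"
      using slpD(8)[OF assms(2)] assms(3) by force
    then have "card (nonterminals G) \<le> card (fst ` set ps)" by (intro card_mono) auto
    also have "\<dots> \<le> length ps" using card_image_le[of "set ps" fst] card_length[of ps] by simp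
    finally show "card (nonterminals G) \<le> length ps" .
  qed
  then show ?thesis by (simp add: L)
qed

section \<open>Comparison of sizes and the resulting compressor\<close>

lemma binary_word_props:
  assumes "w \<noteq> []"
  shows "binary_word w \<noteq> []" "set (binary_word w) \<subseteq> {1..2}" "binary_word w \<in> input_words"
proof -
  show ne: "binary_word w \<noteq> []"
    using assms by (cases w) (auto simp: binary_word_eq encode_word_def unary_code_def)
  show set: "set (binary_word w) \<subseteq> {1..2}"
    by (auto simp: binary_word_eq encode_word_def unary_code_def)
  then show "binary_word w \<in> input_words" using ne unfolding input_words_def by force
qed

lemma smallest_slp_size_binary_word:
  assumes "slp G" "slp_val G = w" "w \<noteq> []"
  shows "smallest_slp_size (binary_word w) \<le> 3 * smallest_slp_size w"
proof -
  obtain H where H: "slp H" "slp_val H = w" "slp_size H = smallest_slp_size w"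
    by (rule smallest_slp_exists[OF assms(1,2)])
  define k where "k = length (letters w)"
  have k: "k = card (set w)"
    using distinct_card[OF distinct_letters, of w] by (simp add: k_def set_letters)
  then have "k > 0" using assms(3) by (simp add: card_gt_0_iff)
  have idx: "letter_index (letters w) a < k" for a
  proof (cases "a \<in> set (letters w)")
    case True
    then show ?thesis using letter_index(1) by (simp add: k_def)
  next
    case False
    then show ?thesis using \<open>k > 0\<close> by (simp add: letter_index_def)
  qed
  let ?G = "encode_grammar k (letter_index (letters w)) H"
  have "smallest_slp_size (binary_word w) \<le> slp_size ?G"
    using slp_encode_grammar[OF H(1) \<open>k > 0\<close> idx] slp_val_encode_grammar[OF H(1) \<open>k > 0\<close> idx]
    by (intro smallest_slp_size_le) (simp_all add: H(2) binary_word_eq)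
  also have "\<dots> \<le> slp_size H + 2 * k" by (rule slp_size_encode_grammar[OF H(1) \<open>k > 0\<close> idx])
  also have "\<dots> \<le> 3 * slp_size H" using card_letters_le_slp_size[OF H(1)] by (simp add: k H(2))
  finally show ?thesis using H(3) by simp
qed

text \<open>Makes the \<open>Max\<close> in \<open>approx_ratio\<close> meaningful: there are
  finitely many words of a given length, among them the power of the letter 1.\<close>

lemma approx_ratio_set:
  "finite {r w | w. length w = n \<and> set w \<subseteq> {1..k}}"
  "k \<ge> 1 \<Longrightarrow> {r w | w. length w = n \<and> set w \<subseteq> {1..k}} \<noteq> {}"
  for r :: "nat list \<Rightarrow> real" and k :: nat
proof -
  have "finite {w. set w \<subseteq> {1..k} \<and> length w = n}" by (rule finite_lists_length_eq) simp
  then have "finite (r ` {w. set w \<subseteq> {1..k} \<and> length w = n})" by (rule finite_imageI)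
  moreover have "{r w | w. length w = n \<and> set w \<subseteq> {1..k}} = r ` {w. set w \<subseteq> {1..k} \<and> length w = n}"
    by blast
  ultimately show "finite {r w | w. length w = n \<and> set w \<subseteq> {1..k}}" by simp
  assume "k \<ge> 1"
  then show "{r w | w. length w = n \<and> set w \<subseteq> {1..k}} \<noteq> {}"
    by (auto intro!: exI[of _ "replicate n 1"])
qed

theorem theorem3p8:
  fixes c :: real
  assumes "c \<ge> 1"
    and "\<exists>C. polytime_compressor C \<and> (\<forall>n\<ge>1. approx_ratio C 2 n \<le> c)"
  shows "\<exists>D. polytime_compressor D \<and> (\<forall>n\<ge>1. approx_ratio D n n \<le> 6 * c)"
proof -
  obtain C where C: "polytime_compressor C" and ratio: "\<And>n. n \<ge> 1 \<Longrightarrow> approx_ratio C 2 n \<le> c"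
    using assms(2) by blast
  have comp: "slp (C w)" "slp_val (C w) = w" if "w \<in> input_words" for w
    using C that unfolding polytime_compressor_def compressor_def by blast+
  have enc_word: "enc_word w = enc w" for w :: "nat list"
    by (simp add: enc_word_def enc_list_def' enc_nat_def)
  have enc_production: "enc_production = enc"
  proof
    show "enc_production p = enc p" for p
      by (cases p) (simp add: enc_list_def' enc_sym_def enc_nat_def)
  qed
  obtain p b where "\<forall>w \<in> input_words. \<exists>y.
      outputs_within p (enc_word w) (poly b (size (enc_word w))) y \<and> encodes_slp y (C w)"
    using C unfolding polytime_compressor_def by blast
  then have "\<forall>w \<in> input_words. \<exists>ps. distinct ps \<and> set ps = productions (C w) \<and>
      outputs_within p (enc w) (poly b (size (enc w))) (enc (start (C w), ps))"
    unfolding encodes_slp_def enc_word by (auto simp: enc_nat_def enc_list_def' enc_production)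
  \<comment> \<open>\<open>encodes_slp\<close> leaves the order of the productions open. Choosing
    the order in the actual output turns that output into a function of \<open>w\<close>, as
    \<open>pt_on\<close> requires.\<close>
  then obtain ps where ps: "\<And>w. w \<in> input_words \<Longrightarrow> distinct (ps w) \<and> set (ps w) = productions (C w) \<and>
      outputs_within p (enc w) (poly b (size (enc w))) (enc (start (C w), ps w))"
    by metis
  have pt_C: "pt_on input_words (\<lambda>w. (start (C w), ps w))"
    unfolding pt_on_def using ps by blast
  have dist: "distinct (map fst (ps w))" if "w \<in> input_words" for w
    using ps[OF that] slpD(7)[OF comp(1)[OF that]] by (auto simp: distinct_map inj_on_def)
  define T where "T = (\<lambda>w. table (letters w) (ps (binary_word w)))"
  define D where "D = (\<lambda>w. decode_grammar (lookup (T w)) (C (binary_word w)))"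
  have ne: "w \<noteq> []" if "w \<in> input_words" for w using that by (simp add: input_words_def)
  have bin: "binary_word w \<in> input_words" if "w \<in> input_words" for w
    using binary_word_props(3) ne[OF that] by blast
  have D: "slp (D w)" "slp_val (D w) = w" "slp_size (D w) \<le> 2 * slp_size (C (binary_word w))"
    if w: "w \<in> input_words" for w
  proof -
    let ?x = "binary_word w"
    note G = comp[OF bin[OF w]]
    obtain v where v: "is_valuation (C ?x) v" using exists_valuation[OF G(1)] by blast
    have d: "letters w \<noteq> []" using ne[OF w] set_letters[of w] by auto
    have dec: "decode 0 (slp_val (C ?x)) = map (letter_index (letters w)) w"
      using decode_encode_word by (simp only: trans[OF G(2) binary_word_eq])
    have L: "lookup (T w) A = rhs_info (letters w) (lookup (T w)) \<alpha>" if "(A, \<alpha>) \<in> productions (C ?x)" for A \<alpha>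
      unfolding T_def using lookup_table[OF dist[OF bin[OF w]] G(1) _ that] ps[OF bin[OF w]] by blast
    have start: "decode 0 (slp_val (C ?x)) \<noteq> []" using dec ne[OF w] by simp
    note props = G(1) v d L start
    show "slp (D w)" unfolding D_def by (rule slp_decode_grammar[OF props])
    have "slp_val (D w) = map (letter (letters w)) (decode 0 (slp_val (C ?x)))"
      unfolding D_def by (rule slp_val_decode_grammar[OF props])
    also have "\<dots> = map (letter (letters w)) (map (letter_index (letters w)) w)"
      by (simp only: dec)
    also have "\<dots> = w"
      unfolding map_map
    proof (rule map_idI)
      fix a assume "a \<in> set w"
      then show "(letter (letters w) \<circ> letter_index (letters w)) a = a"
        using letter_index(1,2)[of a "letters w"]
        by (simp add: letter_def hd0_def set_letters flip: Cons_nth_drop_Suc)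
    qed
    finally show "slp_val (D w) = w" .
    show "slp_size (D w) \<le> 2 * slp_size (C ?x)"
      unfolding D_def by (rule slp_size_decode_grammar[OF props])
  qed
  let ?out = "\<lambda>w. (start (C (binary_word w)), output_productions (T w) (start (C (binary_word w))))"
  have "pt_on input_words ?out"
  proof -
    have "pt_on input_words (\<lambda>w. (start (C (binary_word w)), ps (binary_word w)))"
      by (rule pt_on_comp[OF pt_C]) (use bin in \<open>auto intro: pt_intros\<close>)
    from pt_on_fst[OF this] pt_on_snd[OF this]
    have S: "pt_on input_words (\<lambda>w. start (C (binary_word w)))"
      and P: "pt_on input_words (\<lambda>w. ps (binary_word w))" by simp_all
    show ?thesis unfolding T_def by (intro pt_intros S P)
  qed
  then obtain q b' where q: "\<And>w. w \<in> input_words \<Longrightarrow>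
      outputs_within q (enc w) (poly b' (size (enc w))) (enc (?out w))"
    unfolding pt_on_def by blast
  have "encodes_slp (enc (?out w)) (D w)" if w: "w \<in> input_words" for w
  proof -
    let ?x = "binary_word w"
    have x: "?x \<in> input_words" by (rule bin[OF w])
    have N: "fst ` set (T w) = nonterminals (C ?x)"
      unfolding T_def fst_table(1)[OF dist[OF x]] using ps[OF x] slpD(4,8)[OF comp(1)[OF x]] by force
    have dT: "distinct (map fst (T w))" unfolding T_def by (rule fst_table(2)[OF dist[OF x]])
    have "set (output_productions (T w) (start (C ?x))) = productions (D w)"
      unfolding output_productions_eq(1)[OF dT] D_def decode_grammar_def N by (simp add: Let_def)
    moreover have "start (D w) = start (C ?x)" by (simp add: D_def decode_grammar_def Let_def)
    ultimately show ?thesis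
      unfolding encodes_slp_def using output_productions_eq(2)[OF dT]
      by (intro exI[of _ "output_productions (T w) (start (C ?x))"])
        (simp add: enc_production enc_nat_def enc_list_def')
  qed
  then have poly: "polytime_compressor D"
    unfolding polytime_compressor_def compressor_def enc_word using q D by blast
  have "approx_ratio D n n \<le> 6 * c" if n: "n \<ge> 1" for n
    unfolding approx_ratio_def
  proof (subst Max_le_iff[OF approx_ratio_set(1) approx_ratio_set(2)[OF n]], clarify)
    fix w assume w: "n = length w" "set w \<subseteq> {1..length w}"
    then have iw: "w \<in> input_words" using n by (auto simp: input_words_def)
    let ?x = "binary_word w"
    let ?m = "length ?x"
    have x: "?x \<noteq> []" "set ?x \<subseteq> {1..2}" "?x \<in> input_words"
      using binary_word_props[OF ne[OF iw]] by blast+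
    have g_pos: "smallest_slp_size u > 0" if u: "u \<in> input_words" for u
      using smallest_slp_exists[OF comp[OF u]] slp_size_pos by metis
    \<comment> \<open>The binary word is in general longer than \<open>w\<close>, so the hypothesis
      on \<open>C\<close> is used at the length \<open>?m\<close> instead of
      \<open>n\<close>.\<close>
    have "real (slp_size (C ?x)) / real (smallest_slp_size ?x) \<le> approx_ratio C 2 ?m"
      unfolding approx_ratio_def by (rule Max_ge[OF approx_ratio_set(1)]) (use x(2) in blast)
    also have "\<dots> \<le> c" using ratio[of ?m] x(1) by (simp add: Suc_le_eq)
    finally have Cx: "real (slp_size (C ?x)) \<le> c * real (smallest_slp_size ?x)"
      using g_pos[OF x(3)] by (simp add: divide_le_eq)
    have "real (slp_size (D w)) \<le> 2 * real (slp_size (C ?x))" using D(3)[OF iw] by linarith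
    also have "\<dots> \<le> 2 * (c * real (smallest_slp_size ?x))" using Cx by simp
    also have "\<dots> \<le> 2 * (c * (3 * real (smallest_slp_size w)))"
      using smallest_slp_size_binary_word[OF comp[OF iw] ne[OF iw]] assms(1)
      by (intro mult_left_mono) auto
    finally show "real (slp_size (D w)) / real (smallest_slp_size w) \<le> 6 * c"
      using g_pos[OF iw] by (simp add: divide_le_eq)
  qed
  then show ?thesis using poly by blast
qed

end
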